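(* Let $k$ be a field, let $\Gamma$ be a graph with $n$ vertices, and let $p_t=\dim_k Q(\Gamma)^!_t$ be the Hilbert function of the quadratic algebra $Q(\Gamma)^!$ dual to $Q(\Gamma)$. If $\Gamma$ does not contain two overlapping triangles, then $p_t=0$ for $t>n$ and $p_t\ge p_{n-t}$ for all $t\le n/2$. The equalities $p_t=p_{n-t}$ hold for all $t\le n/2$ if and only if the graph $\Gamma$ is triangle free.
   Context: $\Gamma=(W,E)$ is a graph (a simplicial complex of dimension at most 1, so no loops and no multiple edges) with vertex set $W=\{1,\dots,n\}$ and edge set $E$; edges are written as unordered pairs $(ij)$. A triangle in $\Gamma$ is a set of three pairwise different vertices $i,j,k$ with $(ij),(jk),(ik)\in E$. Two distinct triangles overlap if they have at least one common vertex. The hypothesis that $\Gamma$ does not contain two overlapping triangles is in force for the whole statement, including the final equivalence. $\Gamma$ is triangle free if it contains no triangle. The algebra $Q(\Gamma)$ is the associative unital $k$-algebra with generators $u_i$ ($1\le i\le n$) and $u_{ij}=u_{ji}$ (one generator for each edge $(ij)\in E$), and with the following relations set equal to zero, for all pairwise different indices $i,j,k,l\in\{1,\dots,n\}$: $$R(ij):=[u_i,u_j]-u_{ij}(u_i-u_j),$$ $$R(ijk):=[u_i,u_{jk}]+[u_{ik},u_j]+[u_{ik},u_{jk}]-u_{ij}(u_{ik}-u_{jk}),$$ $$R(ijkl):=[u_{ij},u_{kl}],$$ where $[a,b]=ab-ba$ and $u_{pq}:=0$ whenever $(pq)\notin E$. It is a quadratic algebra graded by giving all generators degree 1. For a quadratic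 algebra $A=T(V)/(R)$ with $V$ finite dimensional and $R\subset V\otimes V$, the quadratic dual algebra is $A^!=T(V^* )/(R^\perp)$, where $R^\perp\subset V^*\otimes V^*$ is the annihilator of $R$; $A^!_t$ denotes its graded component of degree $t$. *)

theory Defs
  imports
    "HOL-Library.Poly_Mapping"
    "HOL-Algebra.QuotRing"
    "HOL-Algebra.Embedded_Algebras"
begin

section \<open>Free associative algebras\<close>

text \<open>
  The free associative unital algebra is the monoid algebra of the free monoid. The convolution
  product on finitely supported functions is written over an additive monoid, so words are wrapped
  in a type whose addition is concatenation and whose zero is the empty word.
\<close>

datatype 'x fmonoid = Wd (letters: "'x list")

instantiation fmonoid :: (type) monoid_add
begin

definition zero_fmonoid :: "'x fmonoid"
  where "zero_fmonoid = Wd []"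

definition plus_fmonoid :: "'x fmonoid \<Rightarrow> 'x fmonoid \<Rightarrow> 'x fmonoid"
  where "plus_fmonoid v w = Wd (letters v @ letters w)"

instance
  by standard (simp_all add: zero_fmonoid_def plus_fmonoid_def)

end

type_synonym ('x, 'k) falg = "'x fmonoid \<Rightarrow>\<^sub>0 'k"

definition scalar :: "'k \<Rightarrow> ('x, 'k::field) falg"
  where "scalar c = Poly_Mapping.single 0 c"

definition generator :: "'x \<Rightarrow> ('x, 'k::field) falg"
  where "generator x = Poly_Mapping.single (Wd [x]) 1"

text \<open>\<open>free_algebra X\<close> is the tensor algebra \<open>T(V)\<close> of the vector space \<open>V\<close> with basis \<open>X\<close>,
  and \<open>tensor_power X t\<close> is \<open>V\<close> tensored with itself \<open>t\<close> times.\<close>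

definition free_algebra :: "'x set \<Rightarrow> ('x, 'k::field) falg ring"
  where "free_algebra X =
    \<lparr>carrier = {f. \<forall>w \<in> Poly_Mapping.keys f. set (letters w) \<subseteq> X},
     mult = (*), one = 1, zero = 0, add = (+)\<rparr>"

definition tensor_power :: "'x set \<Rightarrow> nat \<Rightarrow> ('x, 'k::field) falg set"
  where "tensor_power X t =
    {f. \<forall>w \<in> Poly_Mapping.keys f. set (letters w) \<subseteq> X \<and> length (letters w) = t}"

lemma free_algebra_ring: "ring (free_algebra X :: ('x, 'k::field) falg ring)"
proof -
  have mult: "set (letters w) \<subseteq> X"
    if w: "w \<in> Poly_Mapping.keys (f * g)" and f: "\<forall>w \<in> Poly_Mapping.keys f. set (letters w) \<subseteq> X"
      and g: "\<forall>w \<in> Poly_Mapping.keys g. set (letters w) \<subseteq> X"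
    for f g :: "('x, 'k) falg" and w
  proof -
    obtain u v where "w = u + v" "u \<in> Poly_Mapping.keys f" "v \<in> Poly_Mapping.keys g"
      using w Poly_Mapping.keys_mult[of f g] by blast
    then show ?thesis
      using f g by (auto simp: plus_fmonoid_def)
  qed
  have add: "set (letters w) \<subseteq> X"
    if "w \<in> Poly_Mapping.keys (f + g)" and "\<forall>w \<in> Poly_Mapping.keys f. set (letters w) \<subseteq> X"
      and "\<forall>w \<in> Poly_Mapping.keys g. set (letters w) \<subseteq> X"
    for f g :: "('x, 'k) falg" and w
    using that Poly_Mapping.keys_add[of f g] by blast
  have one: "\<forall>w \<in> Poly_Mapping.keys (1 :: ('x, 'k) falg). set (letters w) \<subseteq> X"
    by (simp add: zero_fmonoid_def)
  show ?thesis
  proof (intro ringI abelian_groupI monoidI)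
    fix f :: "('x, 'k) falg"
    assume "f \<in> carrier (free_algebra X)"
    then show "\<exists>g \<in> carrier (free_algebra X). g \<oplus>\<^bsub>free_algebra X\<^esub> f = \<zero>\<^bsub>free_algebra X\<^esub>"
      by (intro bexI[of _ "- f"]) (simp_all add: free_algebra_def)
  qed (use mult add one in \<open>auto simp: free_algebra_def algebra_simps\<close>)
qed


section \<open>Quadratic algebras and quadratic duality\<close>

text \<open>A quadratic algebra is given by a basis of \<open>V\<close> and a set of elements of \<open>V \<otimes> V\<close>
  spanning the space of relations.\<close>

record (overloaded) ('x, 'k::zero) quadratic =
  gens :: "'x set"
  rels :: "('x, 'k) falg set"

definition relation_ideal :: "('x, 'k::field) quadratic \<Rightarrow> ('x, 'k) falg set"
  where "relation_ideal A = Idl\<^bsub>free_algebra (gens A)\<^esub> (rels A)"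

definition quadratic_algebra :: "('x, 'k::field) quadratic \<Rightarrow> ('x, 'k) falg set ring"
  where "quadratic_algebra A = free_algebra (gens A) Quot relation_ideal A"

definition to_quotient :: "('x, 'k::field) quadratic \<Rightarrow> ('x, 'k) falg \<Rightarrow> ('x, 'k) falg set"
  where "to_quotient A f = relation_ideal A +>\<^bsub>free_algebra (gens A)\<^esub> f"

definition ground_field :: "('x, 'k::field) quadratic \<Rightarrow> ('x, 'k) falg set set"
  where "ground_field A = to_quotient A ` range scalar"

definition graded_component :: "('x, 'k::field) quadratic \<Rightarrow> nat \<Rightarrow> ('x, 'k) falg set set"
  where "graded_component A t = to_quotient A ` tensor_power (gens A) t"

definition hilbert_function :: "('x, 'k::field) quadratic \<Rightarrow> nat \<Rightarrow> nat"
  where "hilbert_function A t =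
    (ring.dim (quadratic_algebra A) over ground_field A) (graded_component A t)"

text \<open>
  The dual space \<open>V\<^sup>*\<close> is written in the basis dual to \<open>X\<close>, indexed by \<open>X\<close> again. In these
  coordinates the pairing of \<open>V\<^sup>* \<otimes> V\<^sup>*\<close> with \<open>V \<otimes> V\<close>, which sends
  \<open>(\<alpha> \<otimes> \<beta>, v \<otimes> w)\<close> to \<open>\<alpha>(v) \<beta>(w)\<close>, is the sum over words of products of coefficients.
  Annihilating the given relations is the same as annihilating their span.
\<close>

definition pairing :: "('x, 'k::field) falg \<Rightarrow> ('x, 'k) falg \<Rightarrow> 'k"
  where "pairing f r = (\<Sum>w \<in> Poly_Mapping.keys f. Poly_Mapping.lookup f w * Poly_Mapping.lookup r w)"

definition quadratic_dual :: "('x, 'k::field) quadratic \<Rightarrow> ('x, 'k) quadratic"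
  where "quadratic_dual A =
    \<lparr>gens = gens A, rels = {f \<in> tensor_power (gens A) 2. \<forall>r \<in> rels A. pairing f r = 0}\<rparr>"


section \<open>Graphs and the algebra of a graph\<close>

definition graph :: "nat \<Rightarrow> nat set set \<Rightarrow> bool"
  where "graph n E \<longleftrightarrow> E \<subseteq> {{i, j} | i j. i \<in> {1..n} \<and> j \<in> {1..n} \<and> i \<noteq> j}"

definition triangle :: "nat set set \<Rightarrow> nat set \<Rightarrow> bool"
  where "triangle E T \<longleftrightarrow> (\<exists>i j k. T = {i, j, k} \<and> i \<noteq> j \<and> j \<noteq> k \<and> i \<noteq> k \<and>
    {i, j} \<in> E \<and> {j, k} \<in> E \<and> {i, k} \<in> E)"

definition overlapping_triangles :: "nat set set \<Rightarrow> bool"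
  where "overlapping_triangles E \<longleftrightarrow>
    (\<exists>S T. triangle E S \<and> triangle E T \<and> S \<noteq> T \<and> S \<inter> T \<noteq> {})"

definition triangle_free :: "nat set set \<Rightarrow> bool"
  where "triangle_free E \<longleftrightarrow> (\<nexists>T. triangle E T)"

datatype gen = Vertex nat | Edge "nat set"

definition commutator :: "'a::ring \<Rightarrow> 'a \<Rightarrow> 'a"
  where "commutator a b = a * b - b * a"

definition uv :: "nat \<Rightarrow> (gen, 'k::field) falg"
  where "uv i = generator (Vertex i)"

definition ue :: "nat set set \<Rightarrow> nat \<Rightarrow> nat \<Rightarrow> (gen, 'k::field) falg"
  where "ue E i j = (if {i, j} \<in> E then generator (Edge {i, j}) else 0)"

definition R2 :: "nat set set \<Rightarrow> nat \<Rightarrow> nat \<Rightarrow> (gen, 'k::field) falg"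
  where "R2 E i j = commutator (uv i) (uv j) - ue E i j * (uv i - uv j)"

definition R3 :: "nat set set \<Rightarrow> nat \<Rightarrow> nat \<Rightarrow> nat \<Rightarrow> (gen, 'k::field) falg"
  where "R3 E i j k =
    commutator (uv i) (ue E j k) + commutator (ue E i k) (uv j) + commutator (ue E i k) (ue E j k)
      - ue E i j * (ue E i k - ue E j k)"

definition R4 :: "nat set set \<Rightarrow> nat \<Rightarrow> nat \<Rightarrow> nat \<Rightarrow> nat \<Rightarrow> (gen, 'k::field) falg"
  where "R4 E i j k l = commutator (ue E i j) (ue E k l)"

definition Q_alg :: "nat \<Rightarrow> nat set set \<Rightarrow> (gen, 'k::field) quadratic"
  where "Q_alg n E =
    \<lparr>gens = Vertex ` {1..n} \<union> Edge ` E,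
     rels =
       {R2 E i j | i j. {i, j} \<subseteq> {1..n} \<and> distinct [i, j]} \<union>
       {R3 E i j k | i j k. {i, j, k} \<subseteq> {1..n} \<and> distinct [i, j, k]} \<union>
       {R4 E i j k l | i j k l. {i, j, k, l} \<subseteq> {1..n} \<and> distinct [i, j, k, l]}\<rparr>"

end

theory Submission
  imports Defs
begin

text \<open>
  Write \<open>a\<^sub>v\<close> and \<open>e\<^sub>i\<^sub>j\<close> for the generators of the dual algebra. Its relations say that generators with
  disjoint supports anticommute, that \<open>a\<^sub>v x = 0\<close> if \<open>v\<close> belongs to the support of \<open>x\<close>, that
  \<open>e\<^sub>u\<^sub>v x = a\<^sub>v x\<close> if \<open>u\<close> does, and that \<open>a\<^sub>i e\<^sub>j\<^sub>k + a\<^sub>j e\<^sub>i\<^sub>k + a\<^sub>k e\<^sub>i\<^sub>j = 0\<close> for every triangle. So the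
  products of generators with pairwise disjoint supports span, that is, the pairs of a matching \<open>M\<close> and
  a set \<open>S\<close> of vertices not covered by \<open>M\<close>; for every triangle one of the three
  products \<open>a\<^sub>v e\<close> inside it can be dropped. The remaining products are linearly independent because
  the generators act on the exterior algebra of all such products: \<open>a\<^sub>v\<close> adds the vertex \<open>v\<close>, and
  \<open>e\<^sub>u\<^sub>v\<close> adds the edge if neither end is occupied, and the free end if only one is.
  A matching with \<open>m\<close> edges contributes \<open>N choose (t - m)\<close> to \<open>p\<^sub>t\<close>, where \<open>N \<le> n - 2 m\<close>, with equality
  when there are no triangles; this gives the symmetry, and a triangle breaks it at \<open>t = 1\<close>.
\<close>

section \<open>Bases of quadratic algebras\<close>

text \<open>The exterior algebra must be divided by the triangle relations before the dual algebra
  can act on it. That quotient is never formed: the action is transposed to functions on sets of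
  generators, and the functions that vanish on all triangle relations form a stable subspace
  \<open>C\<close>, the dual of the quotient. Acting on a member of \<open>C\<close> and evaluating
  at the empty set gives functionals on the free algebra. The relations of the dual algebra are
  given only as an annihilator, so their effect on \<open>C\<close> is not checked on a list of
  them. An element of degree two acts through its pairings with products of generators; antisymmetry
  regroups these into pairings with \<open>R2\<close>, \<open>R3\<close> and \<open>R4\<close>,
  which vanish. Only a vertex and an edge that fill a triangle need the condition in
  \<open>C\<close>. Spanning goes the other way: each rewriting rule is an element orthogonal to all
  defining relations. Since triangles do not overlap, no generator lies inside two of them, so signs
  and dropped products can be chosen triangle by triangle.\<close>

definition monomial :: "'x list \<Rightarrow> ('x, 'k::field) falg"
  where "monomial w = Poly_Mapping.single (Wd w) 1"

definition falg_subspace :: "('x, 'k::field) falg set \<Rightarrow> bool"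
  where "falg_subspace V \<longleftrightarrow> 0 \<in> V \<and> (\<forall>f\<in>V. \<forall>g\<in>V. f + g \<in> V) \<and> (\<forall>c. \<forall>f\<in>V. scalar c * f \<in> V)"

lemma subspaceD:
  assumes "falg_subspace V"
  shows subspace_zero: "0 \<in> V"
    and subspace_add: "f \<in> V \<Longrightarrow> g \<in> V \<Longrightarrow> f + g \<in> V"
    and subspace_scale: "f \<in> V \<Longrightarrow> scalar c * f \<in> V"
  using assms by (auto simp: falg_subspace_def)

lemma scalar_simps:
  shows scalar_0: "scalar 0 = 0" and scalar_1: "scalar 1 = 1"
    and scalar_add: "scalar (a + b) = scalar a + scalar b"
    and scalar_mult: "scalar (a * b) = scalar a * scalar b"
    and scalar_uminus: "scalar (- a) = - scalar a"
  by (simp_all add: scalar_def single_add mult_single single_uminus)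

lemma subspace_uminus:
  assumes "falg_subspace V" "f \<in> V" shows "- f \<in> V"
  using subspace_scale[OF assms, of "- 1"] by (simp add: scalar_simps)

lemma subspace_diff:
  assumes "falg_subspace V" "f \<in> V" "g \<in> V" shows "f - g \<in> V"
  using subspace_add[OF assms(1,2) subspace_uminus[OF assms(1,3)]] by simp

lemma subspace_sum:
  assumes "falg_subspace V" "\<And>x. x \<in> S \<Longrightarrow> f x \<in> V" shows "sum f S \<in> V"
  using assms(2) by (induction S rule: infinite_finite_induct)
    (auto intro: subspace_zero[OF assms(1)] subspace_add[OF assms(1)])

lemma monomial_append: "monomial (v @ w) = monomial v * monomial w"
  by (simp add: monomial_def mult_single plus_fmonoid_def)

lemma monomial_Cons: "monomial (x # w) = generator x * monomial w"
  by (simp add: monomial_def generator_def mult_single plus_fmonoid_def)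

lemma monomial_Nil: "monomial [] = 1"
  by (metis monomial_def single_one zero_fmonoid_def)

lemma falg_expand:
  fixes f :: "('x, 'k::field) falg"
  shows "f = (\<Sum>w\<in>Poly_Mapping.keys f. scalar (Poly_Mapping.lookup f w) * monomial (letters w))"
proof (rule poly_mapping_eqI)
  fix w
  show "Poly_Mapping.lookup f w = Poly_Mapping.lookup
    (\<Sum>w\<in>Poly_Mapping.keys f. scalar (Poly_Mapping.lookup f w) * monomial (letters w)) w"
    by (simp add: lookup_sum scalar_def monomial_def mult_single lookup_single when_def
        sum.delta' in_keys_iff)
qed

definition linear_functional :: "(('x, 'k::field) falg \<Rightarrow> 'k) \<Rightarrow> bool"
  where "linear_functional \<phi> \<longleftrightarrow> (\<forall>f g. \<phi> (f + g) = \<phi> f + \<phi> g) \<and> (\<forall>c f. \<phi> (scalar c * f) = c * \<phi> f)"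

lemma monomial_tensor_power:
  "set w \<subseteq> X \<Longrightarrow> length w = t \<Longrightarrow> monomial w \<in> tensor_power X t"
  by (auto simp: tensor_power_def monomial_def)

lemma keys_scalar_mult:
  "Poly_Mapping.keys (scalar c * f) \<subseteq> Poly_Mapping.keys f"
  using keys_mult[of "scalar c" f] by (auto simp: scalar_def split: if_splits)

lemma subspace_tensor_power: "falg_subspace (tensor_power X t)"
  unfolding falg_subspace_def tensor_power_def
  using Poly_Mapping.keys_add keys_scalar_mult by fastforce

lemma subspace_free_algebra: "falg_subspace (carrier (free_algebra X))"
  unfolding falg_subspace_def free_algebra_def
  using Poly_Mapping.keys_add keys_scalar_mult by fastforce

lemma tensor_power_carrier: "tensor_power X t \<subseteq> carrier (free_algebra X)"
  by (auto simp: tensor_power_def free_algebra_def)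

lemma tensor_power_subspace:
  fixes V :: "('x, 'k::field) falg set"
  assumes V: "falg_subspace V" and "\<And>w. set w \<subseteq> X \<Longrightarrow> length w = t \<Longrightarrow> monomial w \<in> V"
  shows "tensor_power X t \<subseteq> V"
proof
  fix f :: "('x, 'k) falg"
  assume f: "f \<in> tensor_power X t"
  show "f \<in> V"
    by (subst falg_expand, intro subspace_sum[OF V] subspace_scale[OF V] assms(2))
      (use f in \<open>auto simp: tensor_power_def\<close>)
qed

lemma free_algebra_sel [simp]:
  "mult (free_algebra X) = (*)" "add (free_algebra X) = (+)"
  "one (free_algebra X) = 1" "zero (free_algebra X) = 0"
  by (simp_all add: free_algebra_def)

lemma scalar_in_carrier [simp]: "scalar c \<in> carrier (free_algebra X)"
  by (auto simp: free_algebra_def scalar_def zero_fmonoid_def)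

lemma free_algebra_a_inv:
  fixes f :: "('x, 'k::field) falg"
  assumes "f \<in> carrier (free_algebra X)"
  shows "a_inv (free_algebra X) f = - f"
proof -
  interpret R: ring "free_algebra X :: ('x, 'k) falg ring" by (rule free_algebra_ring)
  show ?thesis
    by (rule R.minus_equality) (use assms subspace_uminus[OF subspace_free_algebra] in auto)
qed

lemma subfield_scalars: "subfield (range scalar) (free_algebra X :: ('x, 'k::field) falg ring)"
proof -
  interpret R: ring "free_algebra X :: ('x, 'k) falg ring" by (rule free_algebra_ring)
  have inv: "scalar c * scalar (inverse c) = 1" if "c \<noteq> 0" for c :: 'k
    using that by (simp flip: scalar_mult add: scalar_1)
  show ?thesis
  proof (intro R.subfieldI R.subcringI R.subringI)
    show "Units (free_algebra X \<lparr>carrier := range scalar\<rparr>)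
      = range scalar - {\<zero>\<^bsub>free_algebra X :: ('x, 'k) falg ring\<^esub>}"
      (is "?U = ?K")
    proof
      show "?U \<subseteq> ?K"
        by (auto simp: Units_def)
      show "?K \<subseteq> ?U"
      proof
        fix f assume "f \<in> ?K"
        then obtain c :: 'k where c: "f = scalar c" "c \<noteq> 0"
          using scalar_0 by fastforce
        then show "f \<in> ?U"
          unfolding Units_def using inv[of c] inv[of "inverse c"]
          by (auto intro!: bexI[of _ "scalar (inverse c)"])
      qed
    qed
  qed (auto simp: free_algebra_a_inv simp flip: scalar_add scalar_mult scalar_1 scalar_uminus 
      simp: mult.commute)
qed

text \<open>Both halves of the basis property are stated in the free algebra rather than in the
  quotient. Spanning quantifies over subspaces above the ideal, so no coefficients need names;
  independence asks for functionals that kill the ideal and are dual to the words in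
  \<open>B\<close> up to nonzero factors. The condition on \<open>1\<close> makes the image of the
  scalars in the quotient a field.\<close>

lemma hilbert_function_eq_card:
  fixes A :: "('x, 'k::field) quadratic" and B :: "'x list set"
  assumes rels: "rels A \<subseteq> carrier (free_algebra (gens A))"
    and B: "finite B" "\<And>b. b \<in> B \<Longrightarrow> set b \<subseteq> gens A \<and> length b = t"
    and one: "1 \<notin> relation_ideal A"
    and span: "\<And>V w. falg_subspace V \<Longrightarrow> relation_ideal A \<subseteq> V \<Longrightarrow> (\<forall>b\<in>B. monomial b \<in> V)
      \<Longrightarrow> set w \<subseteq> gens A \<Longrightarrow> length w = t \<Longrightarrow> monomial w \<in> V"
    and dual: "\<And>b. b \<in> B \<Longrightarrow> \<exists>\<phi>. linear_functional \<phi> \<and> (\<forall>f\<in>relation_ideal A. \<phi> f = 0)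
      \<and> \<phi> (monomial b) \<noteq> 0 \<and> (\<forall>b'\<in>B. b' \<noteq> b \<longrightarrow> \<phi> (monomial b') = 0)"
  shows "hilbert_function A t = card B"
proof -
  let ?F = "free_algebra (gens A)" and ?Q = "quadratic_algebra A" and ?I = "relation_ideal A"
  let ?q = "to_quotient A"
  interpret F: ring ?F by (rule free_algebra_ring)
  interpret I: ideal ?I ?F
    unfolding relation_ideal_def by (rule F.genideal_ideal[OF rels])
  interpret Q: ring ?Q
    unfolding quadratic_algebra_def by (rule I.quotient_is_ring)
  have q: "?q = (+>\<^bsub>?F\<^esub>) ?I" by (simp add: to_quotient_def fun_eq_iff)
  interpret h: ring_hom_ring ?F ?Q ?q
    unfolding quadratic_algebra_def q by (rule I.rcos_ring_hom_ring)
  have qeq: "?q f = ?q g \<longleftrightarrow> f - g \<in> ?I" if "f \<in> carrier ?F" "g \<in> carrier ?F" for f g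
  proof -
    have "?q f = ?q g \<longleftrightarrow> f \<ominus>\<^bsub>?F\<^esub> g \<in> ?I"
      unfolding to_quotient_def using that F.quotient_eq_iff_same_a_r_cos[OF I.ideal_axioms] by blast
    also have "f \<ominus>\<^bsub>?F\<^esub> g = f - g"
      using that by (simp add: a_minus_def free_algebra_a_inv)
    finally show ?thesis .
  qed
  have I_carrier: "?I \<subseteq> carrier ?F"
    using I.a_subset .
  have one_ne: "\<one>\<^bsub>?Q\<^esub> \<noteq> \<zero>\<^bsub>?Q\<^esub>"
    using qeq[of 1 0] one h.hom_one h.hom_zero F.one_closed F.zero_closed by auto
  have K: "subfield (ground_field A) ?Q"
    unfolding ground_field_def by (rule h.img_is_subfield(2)[OF subfield_scalars one_ne])
  have mon: "monomial b \<in> carrier ?F" if "b \<in> B" for b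
    using B(2)[OF that] monomial_tensor_power[of b "gens A" t] tensor_power_carrier by blast
  obtain bs where bs: "set bs = B" "distinct bs"
    using finite_distinct_list[OF B(1)] by blast
  define us where "us bs = map (\<lambda>b. ?q (monomial b)) bs" for bs
  have us_carrier: "set (us cs) \<subseteq> carrier ?Q" if "set cs \<subseteq> B" for cs
    using that by (auto simp: us_def intro!: h.hom_closed mon)
  \<comment> \<open>\<open>subalgebra\<close> asks only for closure under addition and under the
    scalars, so it means a vector subspace here.\<close>
  have subalg: "subalgebra (ground_field A) (?q ` V) ?Q"
    if V: "falg_subspace V" "V \<subseteq> carrier ?F" for V
  proof -
    have "subalgebra (range scalar) V ?F"
      unfolding subalgebra_def subalgebra_axioms_def
    proof
      show "subgroup V (add_monoid ?F)"
        by (rule F.add.subgroupI) (use V subspaceD[OF V(1)] subspace_uminus[OF V(1)]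
            in \<open>auto simp: free_algebra_a_inv a_inv_def[symmetric] subset_iff\<close>)
    qed (use subspaceD[OF V(1)] in auto)
    then show ?thesis
      unfolding ground_field_def by (rule h.img_is_subalgebra[rotated]) auto
  qed
  have indep: "Q.independent (ground_field A) (us cs)" if "set cs \<subseteq> B" "distinct cs" for cs
    using that
  proof (induction cs)
    case Nil
    then show ?case by (simp add: us_def)
  next
    case (Cons b cs)
    then obtain \<phi> where \<phi>: "linear_functional \<phi>" "\<And>f. f \<in> ?I \<Longrightarrow> \<phi> f = 0"
      "\<phi> (monomial b) \<noteq> 0" "\<And>b'. b' \<in> B \<Longrightarrow> b' \<noteq> b \<Longrightarrow> \<phi> (monomial b') = 0"
      using dual[of b] by auto
    \<comment> \<open>The kernel of \<open>\<phi>\<close> contains the ideal and the words in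
      \<open>cs\<close>, but not \<open>b\<close>. Its image therefore contains the span of the
      later classes and misses the class of \<open>b\<close>.\<close>
    define V where "V = {f \<in> carrier ?F. \<phi> f = 0}"
    have \<phi>add: "\<phi> (f + g) = \<phi> f + \<phi> g" and \<phi>scale: "\<phi> (scalar c * f) = c * \<phi> f" for f g c
      using \<phi>(1) by (auto simp: linear_functional_def)
    have \<phi>0: "\<phi> 0 = 0" using \<phi>scale[of 0 0] by simp
    have \<phi>diff: "\<phi> (f - g) = \<phi> f - \<phi> g" for f g
      using \<phi>add[of "f - g" g] by simp
    have V: "falg_subspace V" "V \<subseteq> carrier ?F"
      using subspaceD[OF subspace_free_algebra[of "gens A"]]
      by (auto simp: falg_subspace_def V_def \<phi>add \<phi>scale \<phi>0)
    have "set (us cs) \<subseteq> ?q ` V"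
      using Cons.prems mon \<phi>(4) by (fastforce simp: us_def V_def)
    then have span_le: "Q.Span (ground_field A) (us cs) \<subseteq> ?q ` V"
      by (rule Q.subalgebra_Span_incl[OF K subalg[OF V]])
    have "?q (monomial b) \<notin> ?q ` V"
    proof
      assume "?q (monomial b) \<in> ?q ` V"
      then obtain f where f: "f \<in> V" "?q (monomial b) = ?q f" by blast
      then have "monomial b - f \<in> ?I"
        using qeq[THEN iffD1, OF mon _ f(2)] Cons.prems V by auto
      then show False
        using \<phi>(2)[of "monomial b - f"] \<phi>diff \<phi>(3) f(1) by (simp add: V_def)
    qed
    moreover have "?q (monomial b) \<in> carrier ?Q"
      using us_carrier[of "[b]"] Cons.prems by (simp add: us_def)
    ultimately show ?case
      using Cons span_le by (auto simp: us_def intro!: Q.li_Cons)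
  qed
  have "graded_component A t = Q.Span (ground_field A) (us bs)"
  proof (rule Q.Span_subalgebraI[OF K])
    show "subalgebra (ground_field A) (graded_component A t) ?Q"
      unfolding graded_component_def
      by (rule subalg[OF subspace_tensor_power tensor_power_carrier])
    show "set (us bs) \<subseteq> graded_component A t"
      using B(2) bs(1) by (auto simp: us_def graded_component_def intro!: imageI monomial_tensor_power)
    fix W assume W: "subalgebra (ground_field A) W ?Q" "set (us bs) \<subseteq> W"
    interpret W: subalgebra "ground_field A" W ?Q by (rule W(1))
    \<comment> \<open>Pulling \<open>W\<close> back to the free algebra turns minimality of the span
      into the hypothesis \<open>span\<close>.\<close>
    define V where "V = {f \<in> carrier ?F. ?q f \<in> W}"
    have zero: "\<zero>\<^bsub>?Q\<^esub> \<in> W" using W.one_closed by simp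
    have V: "falg_subspace V"
      unfolding falg_subspace_def
    proof (intro conjI ballI allI)
      show "0 \<in> V" using zero h.hom_zero F.zero_closed by (auto simp: V_def)
      fix f g assume "f \<in> V" "g \<in> V"
      then show "f + g \<in> V"
        using W.m_closed[of "?q f" "?q g"] h.hom_add[of f g] F.a_closed[of f g] by (auto simp: V_def)
    next
      fix c f assume f: "f \<in> V"
      have "?q (scalar c) \<in> ground_field A" by (auto simp: ground_field_def)
      then have "?q (scalar c) \<otimes>\<^bsub>?Q\<^esub> ?q f \<in> W"
        using f by (intro W.smult_closed) (auto simp: V_def)
      then show "scalar c * f \<in> V"
        using f h.hom_mult[of "scalar c" f] F.m_closed[of "scalar c" f] by (auto simp: V_def)
    qed
    have "?I \<subseteq> V"
    proof
      fix f assume f: "f \<in> ?I"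
      then have "?q f = ?q 0" using I_carrier F.zero_closed by (subst qeq) auto
      then show "f \<in> V" using h.hom_zero zero f I_carrier by (auto simp: V_def)
    qed
    moreover have "\<forall>b\<in>B. monomial b \<in> V"
      using W(2) bs(1) mon by (auto simp: V_def us_def)
    ultimately have "tensor_power (gens A) t \<subseteq> V"
      using tensor_power_subspace[OF V] span[OF V] by blast
    then show "graded_component A t \<subseteq> W"
      by (auto simp: graded_component_def V_def)
  qed
  then have "Q.dimension (length (us bs)) (ground_field A) (graded_component A t)"
    using Q.dimensionI[OF K indep] bs by auto
  then show ?thesis
    unfolding hilbert_function_def using Q.dimI[OF K] bs distinct_card[OF bs(2)]
    by (simp add: us_def)
qed

section \<open>Modules of functions over the free algebra\<close>

lemma linear_functionalD:
  assumes "linear_functional \<phi>"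
  shows lf_add: "\<phi> (f + g) = \<phi> f + \<phi> g" and lf_scale: "\<phi> (scalar c * f) = c * \<phi> f"
    and lf_zero: "\<phi> 0 = 0" and lf_diff: "\<phi> (f - g) = \<phi> f - \<phi> g" and lf_uminus: "\<phi> (- f) = - \<phi> f"
    and lf_sum: "\<phi> (sum h S) = (\<Sum>x\<in>S. \<phi> (h x))"
proof -
  show add: "\<phi> (f + g) = \<phi> f + \<phi> g" for f g using assms by (simp add: linear_functional_def)
  show scale: "\<phi> (scalar c * f) = c * \<phi> f" for c f using assms by (simp add: linear_functional_def)
  show zero: "\<phi> 0 = 0" using scale[of 0 0] by simp
  show diff: "\<phi> (f - g) = \<phi> f - \<phi> g" for f g using add[of "f - g" g] by simp
  show "\<phi> (- f) = - \<phi> f" using diff[of 0 f] zero by simp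
  show "\<phi> (sum h S) = (\<Sum>x\<in>S. \<phi> (h x))"
    by (induction S rule: infinite_finite_induct) (simp_all add: zero add)
qed

lemma linear_functional_eqI:
  assumes "linear_functional \<phi>" "linear_functional \<psi>" "\<And>w. \<phi> (monomial w) = \<psi> (monomial w)"
  shows "\<phi> f = \<psi> f"
  by (subst (1 2) falg_expand) (simp add: lf_sum[OF assms(1)] lf_sum[OF assms(2)]
      lf_scale[OF assms(1)] lf_scale[OF assms(2)] assms(3))

lemma lookup_scalar_mult:
  "Poly_Mapping.lookup (scalar c * f) w = c * Poly_Mapping.lookup f w"
proof -
  have "scalar c * f = Poly_Mapping.map ((*) c) f"
    by (simp add: scalar_def mult_map_scale_conv_mult)
  then show ?thesis by (simp add: map.rep_eq when_def)
qed

lemma linear_functional_pairing: "linear_functional (pairing f)"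
  by (simp add: linear_functional_def pairing_def lookup_add lookup_scalar_mult
      algebra_simps sum.distrib sum_distrib_left)

lemma scalar_commute: "f * scalar a = scalar a * (f :: ('x, 'k::field) falg)"
proof -
  have mon: "monomial u * scalar a = scalar a * (monomial u :: ('x, 'k) falg)" for u
    by (simp add: monomial_def scalar_def mult_single)
  have "scalar b * monomial u * scalar a = scalar a * (scalar b * (monomial u :: ('x, 'k) falg))" for u b
  proof -
    have "scalar b * monomial u * scalar a = scalar b * scalar a * (monomial u :: ('x, 'k) falg)"
      by (simp add: mult.assoc mon)
    also have "scalar b * scalar a = (scalar a * scalar b :: ('x, 'k) falg)"
      by (simp flip: scalar_mult add: mult.commute)
    finally show ?thesis by (simp add: mult.assoc)
  qed
  then have "(\<Sum>w\<in>S. scalar (b w) * monomial (u w)) * scalar a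
    = scalar a * (\<Sum>w\<in>S. scalar (b w) * (monomial (u w) :: ('x, 'k) falg))" 
    for S :: "'x fmonoid set" and b u
    by (simp add: sum_distrib_left sum_distrib_right)
  note sum_commute = this
  define g where "g = (\<Sum>w\<in>Poly_Mapping.keys f. scalar (Poly_Mapping.lookup f w) * monomial (letters w))"
  have "f = g" unfolding g_def by (rule falg_expand)
  moreover have "g * scalar a = scalar a * g" unfolding g_def by (rule sum_commute)
  ultimately show ?thesis by simp
qed

lemma linear_functional_mult:
  assumes "linear_functional \<phi>"
  shows linear_functional_mult_left: "linear_functional (\<lambda>f. \<phi> (g * f))"
    and linear_functional_mult_right: "linear_functional (\<lambda>f. \<phi> (f * g))"
proof -
  have "g * (scalar a * f) = scalar a * (g * f)" for a f
    by (metis scalar_commute mult.assoc)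
  then show "linear_functional (\<lambda>f. \<phi> (g * f))" "linear_functional (\<lambda>f. \<phi> (f * g))"
    using assms by (simp_all add: linear_functional_def algebra_simps)
qed

text \<open>A family of operators \<open>L x\<close> makes a space of functions into a right module over the free
  algebra: the leftmost letter of a word acts first.\<close>

definition act :: "('x \<Rightarrow> ('s \<Rightarrow> 'k) \<Rightarrow> 's \<Rightarrow> 'k) \<Rightarrow> ('s \<Rightarrow> 'k) \<Rightarrow> ('x, 'k::field) falg \<Rightarrow> 's \<Rightarrow> 'k"
  where "act L c f = (\<lambda>s. \<Sum>w\<in>Poly_Mapping.keys f.
    Poly_Mapping.lookup f w * foldl (\<lambda>c x. L x c) c (letters w) s)"

lemma act_superset:
  assumes "finite S" "Poly_Mapping.keys f \<subseteq> S"
  shows "act L c f s = (\<Sum>w\<in>S. Poly_Mapping.lookup f w * foldl (\<lambda>c x. L x c) c (letters w) s)"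
  unfolding act_def using assms
  by (intro sum.mono_neutral_left) (auto simp: in_keys_iff)

lemma linear_functional_act: "linear_functional (\<lambda>f. act L c f s)"
  unfolding linear_functional_def
proof (intro conjI allI)
  fix f g :: "('a, 'b) falg"
  have "Poly_Mapping.keys (f + g) \<subseteq> Poly_Mapping.keys f \<union> Poly_Mapping.keys g"
    by (rule Poly_Mapping.keys_add)
  then show "act L c (f + g) s = act L c f s + act L c g s"
    by (subst (1 2 3) act_superset[where S = "Poly_Mapping.keys f \<union> Poly_Mapping.keys g"])
      (auto simp: lookup_add algebra_simps sum.distrib)
next
  fix a and f :: "('a, 'b) falg"
  show "act L c (scalar a * f) s = a * act L c f s"
    using keys_scalar_mult[of a f]
    by (subst (1 2) act_superset[where S = "Poly_Mapping.keys f"])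
      (auto simp: lookup_scalar_mult sum_distrib_left mult.assoc)
qed

lemma act_monomial: "act L c (monomial w) = foldl (\<lambda>c x. L x c) c w"
  by (simp add: act_def monomial_def)

locale linear_operators =
  fixes L :: "'x \<Rightarrow> ('s \<Rightarrow> 'k::field) \<Rightarrow> 's \<Rightarrow> 'k"
  assumes L_add: "L x (\<lambda>s. c s + d s) = (\<lambda>s. L x c s + L x d s)"
    and L_scale: "L x (\<lambda>s. a * c s) = (\<lambda>s. a * L x c s)"
begin

lemma foldl_add:
  "foldl (\<lambda>c x. L x c) (\<lambda>s. c s + d s) w
    = (\<lambda>s. foldl (\<lambda>c x. L x c) c w s + foldl (\<lambda>c x. L x c) d w s)"
  by (induction w arbitrary: c d) (simp_all add: L_add)

lemma foldl_scale:
  "foldl (\<lambda>c x. L x c) (\<lambda>s. a * c s) w = (\<lambda>s. a * foldl (\<lambda>c x. L x c) c w s)"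
  by (induction w arbitrary: c) (simp_all add: L_scale)

lemma act_add_left: "act L (\<lambda>s. c s + d s) f = (\<lambda>s. act L c f s + act L d f s)"
  by (simp add: act_def foldl_add algebra_simps sum.distrib)

lemma act_scale_left: "act L (\<lambda>s. a * c s) f = (\<lambda>s. a * act L c f s)"
  by (simp add: act_def foldl_scale algebra_simps sum_distrib_left)

lemma act_zero_left: "act L (\<lambda>s. 0) f = (\<lambda>s. 0)"
  using act_scale_left[of 0 "\<lambda>s. 0" f] by simp

text \<open>Linearity in each factor reduces this to words, where it is the behaviour of
  \<open>foldl\<close> on a concatenation.\<close>

lemma act_mult: "act L c (f * g) = act L (act L c f) g"
proof
  fix s
  have left: "linear_functional (\<lambda>f. act L c (f * g) s)" for g
    by (rule linear_functional_mult_right[OF linear_functional_act])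
  have left': "linear_functional (\<lambda>f. act L (act L c f) g s)" for g
  proof -
    have "act L c (f + h) = (\<lambda>s. act L c f s + act L c h s)"
      "act L c (scalar a * f) = (\<lambda>s. a * act L c f s)" for f h a
      using linear_functional_act[of L c] by (auto simp: linear_functional_def)
    then show ?thesis
      by (simp add: linear_functional_def act_add_left act_scale_left)
  qed
  have right: "linear_functional (\<lambda>g. act L c (monomial u * g) s)" for u
    by (rule linear_functional_mult_left[OF linear_functional_act])
  show "act L c (f * g) s = act L (act L c f) g s"
  proof (rule linear_functional_eqI[OF left left'])
    fix u
    show "act L c (monomial u * g) s = act L (act L c (monomial u)) g s"
      by (rule linear_functional_eqI[OF right linear_functional_act])
        (simp add: act_monomial flip: monomial_append)
  qed
qed

text \<open>The elements that annihilate all of \<open>C\<close> form a two-sided ideal: left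
  multiples stay in it because \<open>C\<close> is stable under the operators, right multiples
  because the zero function is sent to zero. So it is enough to test the generating
  relations.\<close>

lemma act_relation_ideal:
  fixes A :: "('x, 'k) quadratic"
  assumes rels: "rels A \<subseteq> carrier (free_algebra (gens A))"
    and C_add: "\<And>c d. c \<in> C \<Longrightarrow> d \<in> C \<Longrightarrow> (\<lambda>s. c s + d s) \<in> C"
    and C_scale: "\<And>a c. c \<in> C \<Longrightarrow> (\<lambda>s. a * c s) \<in> C"
    and C_zero: "(\<lambda>s. 0) \<in> C"
    and C_L: "\<And>x c. x \<in> gens A \<Longrightarrow> c \<in> C \<Longrightarrow> L x c \<in> C"
    and C_rels: "\<And>r c. r \<in> rels A \<Longrightarrow> c \<in> C \<Longrightarrow> act L c r = (\<lambda>s. 0)"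
    and f: "f \<in> relation_ideal A" and c: "c \<in> C"
  shows "act L c f = (\<lambda>s. 0)"
proof -
  let ?F = "free_algebra (gens A)"
  interpret F: ring ?F by (rule free_algebra_ring)
  have C_sum: "(\<lambda>s. \<Sum>i\<in>I. h i s) \<in> C" if "\<And>i. i \<in> I \<Longrightarrow> h i \<in> C" for I :: "'x fmonoid set" and h
    using that by (induction I rule: infinite_finite_induct) (auto simp: C_zero C_add)
  have fold: "foldl (\<lambda>c x. L x c) c w \<in> C" if "set w \<subseteq> gens A" "c \<in> C" for c w
    using that by (induction w arbitrary: c) (auto simp: C_L)
  have act_C: "act L c u \<in> C" if "c \<in> C" "u \<in> carrier ?F" for c u
    unfolding act_def using that by (intro C_sum C_scale fold) (auto simp: free_algebra_def)
  define J where "J = {f \<in> carrier ?F. \<forall>c\<in>C. act L c f = (\<lambda>s. 0)}"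
  have lin: "act L c (f + g) = (\<lambda>s. act L c f s + act L c g s)" "act L c 0 = (\<lambda>s. 0)"
    "act L c (- f) = (\<lambda>s. - act L c f s)" for c f g
    by (simp_all add: fun_eq_iff lf_add[OF linear_functional_act] lf_zero[OF linear_functional_act]
      lf_uminus[OF linear_functional_act])
  have "ideal J ?F"
  proof (rule idealI)
    show "ring ?F" by (rule free_algebra_ring)
    show "subgroup J (add_monoid ?F)"
      by (rule F.add.subgroupI) (use subspaceD[OF subspace_free_algebra[of "gens A"]]
          subspace_uminus[OF subspace_free_algebra[of "gens A"]]
          in \<open>auto simp: J_def lin free_algebra_a_inv a_inv_def[symmetric]\<close>)
  next
    fix f u :: "('x, 'k) falg"
    assume "f \<in> J" "u \<in> carrier ?F"
    then show "u \<otimes>\<^bsub>?F\<^esub> f \<in> J" "f \<otimes>\<^bsub>?F\<^esub> u \<in> J"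
      using F.m_closed[of u f] F.m_closed[of f u]
      by (auto simp: J_def act_mult act_C act_zero_left)
  qed
  moreover have "rels A \<subseteq> J"
    using rels C_rels by (auto simp: J_def)
  ultimately have "relation_ideal A \<subseteq> J"
    unfolding relation_ideal_def by (rule F.genideal_minimal)
  with f c show ?thesis by (auto simp: J_def)
qed

end

section \<open>States of a graph\<close>

fun supp :: "gen \<Rightarrow> nat set"
  where "supp (Vertex v) = {v}" | "supp (Edge e) = e"

definition touched :: "gen set \<Rightarrow> nat set"
  where "touched X = (\<Union>g\<in>X. supp g)"

lemma touched_insert [simp]: "touched (insert g X) = supp g \<union> touched X"
  and touched_Un [simp]: "touched (X \<union> Y) = touched X \<union> touched Y"
  and touched_empty [simp]: "touched {} = {}"
  by (auto simp: touched_def)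

lemma supp_touched: "g \<in> X \<Longrightarrow> supp g \<subseteq> touched X"
  by (auto simp: touched_def)

text \<open>This form is symmetric in the three vertices and writes the edge opposite
  \<open>v\<close> as \<open>T - {v}\<close>, so that triangle relations become sums over
  \<open>v \<in> T\<close>.\<close>

lemma triangle_iff: "triangle E T \<longleftrightarrow> card T = 3 \<and> (\<forall>v\<in>T. T - {v} \<in> E)"
proof
  assume "triangle E T"
  then obtain i j k where T: "T = {i, j, k}" "i \<noteq> j" "j \<noteq> k" "i \<noteq> k"
    "{i, j} \<in> E" "{j, k} \<in> E" "{i, k} \<in> E"
    unfolding triangle_def by blast
  have d: "T - {i} = {j, k}" "T - {j} = {i, k}" "T - {k} = {i, j}"
    unfolding T(1) using T(2-4) by blast+
  have "\<forall>v\<in>{i, j, k}. T - {v} \<in> E"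
    using T(5-7) by (simp add: d)
  then show "card T = 3 \<and> (\<forall>v\<in>T. T - {v} \<in> E)" using T(1-4) by simp
next
  assume T: "card T = 3 \<and> (\<forall>v\<in>T. T - {v} \<in> E)"
  then obtain i j k where ijk: "T = {i, j, k}" "i \<noteq> j" "j \<noteq> k" "i \<noteq> k"
    unfolding card_3_iff by blast
  have d: "T - {i} = {j, k}" "T - {j} = {i, k}" "T - {k} = {i, j}"
    unfolding ijk(1) using ijk(2-4) by blast+
  have TE: "T - {i} \<in> E" "T - {j} \<in> E" "T - {k} \<in> E" using T ijk(1) by blast+
  then have "{j, k} \<in> E" "{i, k} \<in> E" "{i, j} \<in> E"
    by (simp_all only: d)
  then show "triangle E T"
    unfolding triangle_def using ijk by blast
qed

locale graph_no_overlap =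
  fixes n :: nat and E :: "nat set set"
  assumes graph: "graph n E" and no_overlap: "\<not> overlapping_triangles E"
begin

definition G :: "gen set"
  where "G = Vertex ` {1..n} \<union> Edge ` E"

lemma edgeE:
  assumes "e \<in> E" obtains i j where "e = {i, j}" "i \<noteq> j" "i \<in> {1..n}" "j \<in> {1..n}"
  using graph assms unfolding graph_def by blast

lemma finite_E: "finite E"
proof -
  have "E \<subseteq> Pow {1..n}" by (auto elim!: edgeE)
  then show ?thesis by (rule finite_subset) simp
qed

lemma finite_G: "finite G"
  by (simp add: G_def finite_E)

lemma G_simps [simp]: "Vertex v \<in> G \<longleftrightarrow> v \<in> {1..n}" "Edge e \<in> G \<longleftrightarrow> e \<in> E"
  by (auto simp: G_def)

lemma supp_G: "g \<in> G \<Longrightarrow> supp g \<subseteq> {1..n}" "g \<in> G \<Longrightarrow> supp g \<noteq> {}" "g \<in> G \<Longrightarrow> finite (supp g)"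
  by (auto simp: G_def elim!: edgeE)

lemma touched_G: "X \<subseteq> G \<Longrightarrow> touched X \<subseteq> {1..n}"
  using supp_G(1) by (force simp: touched_def)

lemma finite_touched: "X \<subseteq> G \<Longrightarrow> finite (touched X)"
  using touched_G finite_subset by blast

lemma not_in_untouched: "g \<in> G \<Longrightarrow> supp g \<inter> touched X = {} \<Longrightarrow> g \<notin> X"
  using supp_G(2) supp_touched by fast

lemma triangleD:
  assumes "triangle E T"
  shows triangle_card: "card T = 3" and triangle_finite: "finite T"
    and triangle_edge: "v \<in> T \<Longrightarrow> T - {v} \<in> E" and triangle_le: "T \<subseteq> {1..n}"
proof -
  show c: "card T = 3" and e: "v \<in> T \<Longrightarrow> T - {v} \<in> E" for v
    using assms by (auto simp: triangle_iff)
  show "finite T" using c by (metis card.infinite zero_neq_numeral)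
  show "T \<subseteq> {1..n}"
  proof
    fix v assume v: "v \<in> T"
    have "card (T - {v}) = 2" using c v by simp
    then obtain w where w: "w \<in> T" "w \<noteq> v"
      by (metis Diff_iff card.empty empty_iff equals0I insertCI zero_neq_numeral)
    show "v \<in> {1..n}" using e[OF w(1)] v w(2) supp_G(1)[of "Edge (T - {w})"] by auto
  qed
qed

lemma triangle_disjoint:
  "triangle E S \<Longrightarrow> triangle E T \<Longrightarrow> S \<noteq> T \<Longrightarrow> S \<inter> T = {}"
  using no_overlap unfolding overlapping_triangles_def by blast

lemma finite_triangles: "finite {T. triangle E T}"
proof (rule finite_subset)
  show "{T. triangle E T} \<subseteq> Pow {1..n}" using triangle_le by auto
qed simp

definition vertex_edge :: "nat set \<Rightarrow> nat \<Rightarrow> gen set"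
  where "vertex_edge T v = {Vertex v, Edge (T - {v})}"

lemma touched_vertex_edge: "v \<in> T \<Longrightarrow> touched (vertex_edge T v) = T"
  by (auto simp: vertex_edge_def)

lemma vertex_edge_G: "triangle E T \<Longrightarrow> v \<in> T \<Longrightarrow> vertex_edge T v \<subseteq> G"
  using triangle_le[of T] by (auto simp: vertex_edge_def triangle_edge)

end

text \<open>Any antisymmetric choice \<open>\<sigma>\<close> of signs makes the operators that add a generator anticommute. Giving
  all generators inside one triangle the same sign against the others makes the three terms of the
  triangle relation appear with equal signs.\<close>

locale signed_graph = graph_no_overlap +
  fixes \<sigma> :: "gen \<Rightarrow> gen \<Rightarrow> 'k::field"
  assumes \<sigma>_anti: "g \<in> G \<Longrightarrow> h \<in> G \<Longrightarrow> g \<noteq> h \<Longrightarrow> \<sigma> g h = - \<sigma> h g"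
    and \<sigma>_square: "\<sigma> g h * \<sigma> g h = 1"
    and \<sigma>_triangle: "triangle E T \<Longrightarrow> g \<in> G \<Longrightarrow> g' \<in> G \<Longrightarrow> h \<in> G \<Longrightarrow> supp g \<subseteq> T \<Longrightarrow> supp g' \<subseteq> T
      \<Longrightarrow> \<not> supp h \<subseteq> T \<Longrightarrow> \<sigma> g h = \<sigma> g' h"
    and \<sigma>_inside: "triangle E T \<Longrightarrow> v \<in> T \<Longrightarrow> e \<in> E \<Longrightarrow> e \<subseteq> T \<Longrightarrow> \<sigma> (Vertex v) (Edge e) = 1"
begin

lemma \<sigma>_triangle':
  assumes "triangle E T" "g \<in> G" "g' \<in> G" "h \<in> G" "supp g \<subseteq> T" "supp g' \<subseteq> T" "\<not> supp h \<subseteq> T"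
  shows "\<sigma> h g = \<sigma> h g'"
proof -
  have "g \<noteq> h" "g' \<noteq> h" using assms by auto
  then show ?thesis
    using \<sigma>_triangle[OF assms] \<sigma>_anti[of h g] \<sigma>_anti[of h g'] assms by auto
qed

text \<open>The sign of multiplying the basis vector of \<open>X\<close> by \<open>g\<close> in an
  exterior algebra whose basis is indexed by sets: if \<sigma> comes from a linear order, it is -1
  to the number of members of \<open>X\<close> that precede \<open>g\<close>.\<close>

definition sgn_add :: "gen \<Rightarrow> gen set \<Rightarrow> 'k"
  where "sgn_add g X = (\<Prod>h\<in>X. \<sigma> g h)"

definition ins :: "(gen set \<Rightarrow> 'k) \<Rightarrow> gen \<Rightarrow> gen set \<Rightarrow> 'k"
  where "ins c g X = (if supp g \<inter> touched X = {} then sgn_add g X * c (insert g X) else 0)"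

text \<open>Transposed action of the generators: \<open>L x c\<close> evaluates \<open>c\<close> after \<open>x\<close> has acted on a state.\<close>

fun L :: "gen \<Rightarrow> (gen set \<Rightarrow> 'k) \<Rightarrow> gen set \<Rightarrow> 'k"
  where "L (Vertex v) c X = (if X \<subseteq> G then ins c (Vertex v) X else 0)"
  | "L (Edge e) c X = (if X \<subseteq> G then
      (if e \<inter> touched X = {} then ins c (Edge e) X else \<Sum>v\<in>e - touched X. ins c (Vertex v) X) else 0)"

lemma ins_add: "ins (\<lambda>s. c s + d s) g X = ins c g X + ins d g X"
  and ins_scale: "ins (\<lambda>s. a * c s) g X = a * ins c g X"
  by (simp_all add: ins_def algebra_simps)

sublocale linear_operators L
proof
  show "L x (\<lambda>s. c s + d s) = (\<lambda>s. L x c s + L x d s)" for x c d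
    by (cases x) (auto simp: fun_eq_iff ins_add sum.distrib)
  show "L x (\<lambda>s. a * c s) = (\<lambda>s. a * L x c s)" for x a c
    by (cases x) (auto simp: fun_eq_iff ins_scale sum_distrib_left)
qed

lemma sgn_add_insert: "X \<subseteq> G \<Longrightarrow> h \<notin> X \<Longrightarrow> sgn_add g (insert h X) = \<sigma> g h * sgn_add g X"
  using finite_subset[OF _ finite_G] by (simp add: sgn_add_def)

text \<open>Both sides are \<open>c\<close> at the same set, with the same signs against
  \<open>X\<close>; they differ only in having \<sigma> of \<open>h\<close> against \<open>g\<close>
  or of \<open>g\<close> against \<open>h\<close>.\<close>

lemma ins_anticommute:
  assumes "X \<subseteq> G" "g \<in> G" "h \<in> G" "supp g \<inter> touched X = {}" "supp h \<inter> touched X = {}"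
    "supp g \<inter> supp h = {}"
  shows "sgn_add g X * ins c h (insert g X) = - (sgn_add h X * ins c g (insert h X))"
proof -
  have "g \<notin> X" "h \<notin> X" "g \<noteq> h"
    using assms not_in_untouched supp_G(2) by auto
  then show ?thesis
    using assms \<sigma>_anti[of g h]
    by (auto simp: ins_def sgn_add_insert insert_commute Int_Un_distrib Int_commute algebra_simps)
qed

text \<open>The functionals that vanish on the triangle relations.\<close>

definition C :: "(gen set \<Rightarrow> 'k) set"
  where "C = {c. \<forall>X T. X \<subseteq> G \<longrightarrow> triangle E T \<longrightarrow> T \<inter> touched X = {}
    \<longrightarrow> (\<Sum>v\<in>T. c (vertex_edge T v \<union> X)) = 0}"

text \<open>The vertex and the edge of the pair contribute equal signs against \<open>g\<close>,
  whose product is 1. The sign therefore does not depend on \<open>v\<close> and can leave a sum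
  over the triangle.\<close>

lemma sgn_add_vertex_edge:
  assumes "X \<subseteq> G" "triangle E T" "v \<in> T" "T \<inter> touched X = {}" "g \<in> G" "\<not> supp g \<subseteq> T"
  shows "sgn_add g (vertex_edge T v \<union> X) = sgn_add g X"
proof -
  have ve: "Vertex v \<in> G" "Edge (T - {v}) \<in> G"
    using vertex_edge_G[OF assms(2,3)] by (auto simp: vertex_edge_def)
  have "Vertex v \<notin> X" "Edge (T - {v}) \<notin> X"
    using assms not_in_untouched[OF ve(1), of X] not_in_untouched[OF ve(2), of X] by auto
  moreover have "\<sigma> g (Vertex v) = \<sigma> g (Edge (T - {v}))"
    by (rule \<sigma>_triangle'[OF assms(2) ve assms(5)]) (use assms in auto)
  ultimately show ?thesis
    using assms(1) ve by (simp add: vertex_edge_def sgn_add_insert \<sigma>_square flip: mult.assoc)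
qed

text \<open>If \<open>g\<close> meets \<open>T\<close> or \<open>X\<close>, every term is 0.
  Otherwise the sign factors out and the condition defining \<open>C\<close>, taken at
  \<open>insert g X\<close>, remains.\<close>

lemma ins_C:
  assumes c: "c \<in> C" and X: "X \<subseteq> G" "triangle E T" "T \<inter> touched X = {}" and g: "g \<in> G"
  shows "(\<Sum>v\<in>T. ins c g (vertex_edge T v \<union> X)) = 0"
proof (cases "supp g \<inter> (T \<union> touched X) = {}")
  case True
  then have g': "\<not> supp g \<subseteq> T" using supp_G(2)[OF g] by blast
  have "(\<Sum>v\<in>T. ins c g (vertex_edge T v \<union> X))
      = (\<Sum>v\<in>T. sgn_add g X * c (vertex_edge T v \<union> insert g X))"
    using True g g' X
    by (intro sum.cong) (auto simp: ins_def touched_vertex_edge sgn_add_vertex_edge)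
  also have "\<dots> = sgn_add g X * (\<Sum>v\<in>T. c (vertex_edge T v \<union> insert g X))"
    by (simp add: sum_distrib_left)
  also have "(\<Sum>v\<in>T. c (vertex_edge T v \<union> insert g X)) = 0"
  proof -
    have "insert g X \<subseteq> G" "T \<inter> touched (insert g X) = {}" using X g True by auto
    then show ?thesis using c X(2) unfolding C_def by blast
  qed
  finally show ?thesis by simp
qed (auto simp: ins_def touched_vertex_edge intro!: sum.neutral)

text \<open>The three vertex-edge states of a triangle touch the same vertices, namely
  \<open>T\<close>, so an edge is resolved into the same free ends on each of them and
  \<open>ins_C\<close> applies end by end.\<close>

lemma L_C:
  assumes c: "c \<in> C" and x: "x \<in> G" shows "L x c \<in> C"
  unfolding C_def
proof (intro CollectI allI impI)
  fix X T assume X: "X \<subseteq> G" "triangle E T" "T \<inter> touched X = {}"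
  have G: "vertex_edge T v \<union> X \<subseteq> G" if "v \<in> T" for v
    using X vertex_edge_G that by auto
  show "(\<Sum>v\<in>T. L x c (vertex_edge T v \<union> X)) = 0"
  proof (cases x)
    case (Vertex w)
    then show ?thesis using ins_C[OF c X x] G by simp
  next
    case (Edge e)
    show ?thesis
    proof (cases "e \<inter> (T \<union> touched X) = {}")
      case True
      then show ?thesis using ins_C[OF c X x] G Edge by (simp add: touched_vertex_edge)
    next
      case False
      have "(\<Sum>v\<in>T. L x c (vertex_edge T v \<union> X))
        = (\<Sum>v\<in>T. \<Sum>w\<in>e - (T \<union> touched X). ins c (Vertex w) (vertex_edge T v \<union> X))"
        using False G Edge by (intro sum.cong) (auto simp: touched_vertex_edge)
      also have "\<dots> = (\<Sum>w\<in>e - (T \<union> touched X). \<Sum>v\<in>T. ins c (Vertex w) (vertex_edge T v \<union> X))"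
        by (rule sum.swap)
      also have "\<dots> = 0"
        using x Edge by (intro sum.neutral ballI ins_C[OF c X]) (auto elim: edgeE)
      finally show ?thesis .
    qed
  qed
qed

text \<open>\<open>W v T\<close> collects the generators that add the vertex \<open>v\<close> to a state occupying the vertices \<open>T\<close>.\<close>

definition W :: "nat \<Rightarrow> nat set \<Rightarrow> (gen, 'k) falg"
  where "W v T = uv v + (\<Sum>w\<in>T. ue E v w)"

text \<open>The generators are regrouped by their effect on \<open>X\<close>. Edges away from
  \<open>X\<close> are added whole; an edge with exactly one end in \<open>X\<close> adds its free
  end and so joins the generator of that vertex in \<open>W\<close>; an edge with both ends in
  \<open>X\<close> contributes an empty sum.\<close>

lemma sum_L:
  assumes lf: "linear_functional \<phi>" and X: "X \<subseteq> G"
  shows "(\<Sum>x\<in>G. \<phi> (generator x) * L x c X)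
    = (\<Sum>v\<in>{1..n} - touched X. \<phi> (W v (touched X)) * ins c (Vertex v) X)
      + (\<Sum>e | e \<in> E \<and> e \<inter> touched X = {}. \<phi> (generator (Edge e)) * ins c (Edge e) X)"
proof -
  let ?T = "touched X" and ?F = "{1..n} - touched X"
  let ?E0 = "{e \<in> E. e \<inter> ?T = {}}" and ?E1 = "{e \<in> E. e \<inter> ?T \<noteq> {}}"
  have "(\<Sum>x\<in>G. \<phi> (generator x) * L x c X)
      = (\<Sum>v\<in>{1..n}. \<phi> (uv v) * L (Vertex v) c X) + (\<Sum>e\<in>E. \<phi> (generator (Edge e)) * L (Edge e) c X)"
    unfolding G_def uv_def
    by (subst sum.union_disjoint) (auto simp: finite_E sum.reindex inj_on_def)
  also have "(\<Sum>v\<in>{1..n}. \<phi> (uv v) * L (Vertex v) c X) = (\<Sum>v\<in>?F. \<phi> (uv v) * ins c (Vertex v) X)"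
    using X by (intro sum.mono_neutral_cong_right) (auto simp: ins_def)
  also have "(\<Sum>e\<in>E. \<phi> (generator (Edge e)) * L (Edge e) c X)
    = (\<Sum>e\<in>?E0. \<phi> (generator (Edge e)) * L (Edge e) c X)
    + (\<Sum>e\<in>?E1. \<phi> (generator (Edge e)) * L (Edge e) c X)"
    by (subst sum.union_disjoint[symmetric]) (auto simp: finite_E intro!: sum.cong)
  also have "(\<Sum>e\<in>?E0. \<phi> (generator (Edge e)) * L (Edge e) c X)
    = (\<Sum>e\<in>?E0. \<phi> (generator (Edge e)) * ins c (Edge e) X)"
    using X by (intro sum.cong) auto
  also have "(\<Sum>e\<in>?E1. \<phi> (generator (Edge e)) * L (Edge e) c X)
    = (\<Sum>e\<in>?E1. \<Sum>v\<in>?F. if v \<in> e then \<phi> (generator (Edge e)) * ins c (Vertex v) X else 0)"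
  proof (rule sum.cong)
    fix e assume e: "e \<in> ?E1"
    then have "e - ?T \<subseteq> ?F" using supp_G(1)[of "Edge e"] by auto
    then have "?F \<inter> {v. v \<in> e} = e - ?T" by auto
    then show "\<phi> (generator (Edge e)) * L (Edge e) c X
      = (\<Sum>v\<in>?F. if v \<in> e then \<phi> (generator (Edge e)) * ins c (Vertex v) X else 0)"
      using e X by (simp add: sum_distrib_left sum.If_cases)
  qed simp
  also have "\<dots> = (\<Sum>v\<in>?F. \<Sum>e\<in>?E1. if v \<in> e then \<phi> (generator (Edge e)) * ins c (Vertex v) X else 0)"
    by (rule sum.swap)
  also have "\<dots> = (\<Sum>v\<in>?F. \<phi> (\<Sum>w\<in>?T. ue E v w) * ins c (Vertex v) X)"
  proof (rule sum.cong)
    fix v assume v: "v \<in> ?F"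
    have "(\<Sum>e\<in>?E1. if v \<in> e then \<phi> (generator (Edge e)) * ins c (Vertex v) X else 0)
        = (\<Sum>e\<in>{e \<in> ?E1. v \<in> e}. \<phi> (generator (Edge e)) * ins c (Vertex v) X)"
      by (rule sum.inter_filter[symmetric]) (simp add: finite_E)
    \<comment> \<open>The edges through the free vertex \<open>v\<close> that meet the occupied
      vertices correspond to their other ends.\<close>
    also have "\<dots> = (\<Sum>w\<in>{w \<in> ?T. {v, w} \<in> E}. \<phi> (generator (Edge {v, w})) * ins c (Vertex v) X)"
    proof (rule sum.reindex_bij_betw[symmetric])
      show "bij_betw (\<lambda>w. {v, w}) {w \<in> ?T. {v, w} \<in> E} {e \<in> ?E1. v \<in> e}"
      proof (rule bij_betw_imageI)
        show "inj_on (\<lambda>w. {v, w}) {w \<in> ?T. {v, w} \<in> E}"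
          by (auto simp: inj_on_def doubleton_eq_iff)
        show "(\<lambda>w. {v, w}) ` {w \<in> ?T. {v, w} \<in> E} = {e \<in> ?E1. v \<in> e}"
        proof
          show "{e \<in> ?E1. v \<in> e} \<subseteq> (\<lambda>w. {v, w}) ` {w \<in> ?T. {v, w} \<in> E}"
          proof
            fix e assume e: "e \<in> {e \<in> ?E1. v \<in> e}"
            then obtain i j where "e = {i, j}" using edgeE by blast
            with e obtain w where "e = {v, w}" by auto
            with e v show "e \<in> (\<lambda>w. {v, w}) ` {w \<in> ?T. {v, w} \<in> E}" by auto
          qed
        qed auto
      qed
    qed
    also have "\<dots> = (\<Sum>w\<in>?T. \<phi> (ue E v w) * ins c (Vertex v) X)"
      using finite_touched[OF X]
      by (intro sum.mono_neutral_cong_left) (auto simp: ue_def lf_zero[OF lf])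
    also have "\<dots> = \<phi> (\<Sum>w\<in>?T. ue E v w) * ins c (Vertex v) X"
      by (simp add: lf_sum[OF lf] sum_distrib_right)
    finally show "(\<Sum>e\<in>?E1. if v \<in> e then \<phi> (generator (Edge e)) * ins c (Vertex v) X else 0)
      = \<phi> (\<Sum>w\<in>?T. ue E v w) * ins c (Vertex v) X" .
  qed simp
  finally show ?thesis
    by (simp add: W_def lf_add[OF lf] algebra_simps sum.distrib)
qed

end

section \<open>Relations of the dual algebra\<close>

lemma commutator_sum_left: "commutator (sum f S) b = (\<Sum>x\<in>S. commutator (f x) b)"
  and commutator_sum_right: "commutator a (sum f S) = (\<Sum>x\<in>S. commutator a (f x))"
  by (simp_all add: commutator_def sum_distrib_left sum_distrib_right sum_subtractf)

lemma pairing_monomial: "pairing f (monomial w) = Poly_Mapping.lookup f (Wd w)"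
  by (simp add: pairing_def monomial_def lookup_single when_def in_keys_iff
      if_distrib[of "(*) _"] sum.delta cong: if_cong)

text \<open>The off-diagonal terms cancel in pairs. The diagonal of \<open>d\<close> is assumed to
  vanish separately because antisymmetry does not give this in characteristic 2.\<close>

lemma sum_symmetric_antisymmetric:
  fixes a d :: "'i \<Rightarrow> 'i \<Rightarrow> 'k::comm_ring"
  assumes "finite S" "\<And>u v. u \<in> S \<Longrightarrow> v \<in> S \<Longrightarrow> u \<noteq> v \<Longrightarrow> a u v = a v u"
    "\<And>u v. u \<in> S \<Longrightarrow> v \<in> S \<Longrightarrow> d u v = - d v u" "\<And>u. u \<in> S \<Longrightarrow> d u u = 0"
  shows "(\<Sum>v\<in>S. \<Sum>u\<in>S. a u v * d u v) = 0"
  using assms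
proof (induction S rule: finite_induct)
  case (insert x S)
  have "(\<Sum>u\<in>S. a u x * d u x) = - (\<Sum>v\<in>S. a x v * d x v)"
    unfolding sum_negf[symmetric]
  proof (rule sum.cong)
    fix u assume "u \<in> S"
    moreover from this have "u \<noteq> x" using insert.hyps(2) by blast
    ultimately have "a u x = a x u" "d u x = - d x u"
      using insert.prems(1)[of u x] insert.prems(2)[of u x] by simp_all
    then show "a u x * d u x = - (a x u * d x u)" by simp
  qed simp
  moreover have "(\<Sum>v\<in>S. \<Sum>u\<in>S. a u v * d u v) = 0"
    by (rule insert.IH) (rule insert.prems; simp)+
  ultimately show ?case
    using insert.hyps insert.prems(3)[of x] by (simp add: sum.distrib)
qed simp

lemma pairing_generators:
  "pairing f (generator x * generator y) = Poly_Mapping.lookup f (Wd [x, y])"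
  using pairing_monomial[of f "[x, y]"] by (simp add: monomial_Cons monomial_Nil)

context graph_no_overlap
begin

lemma gens_Q_alg [simp]: "gens (Q_alg n E) = G"
  by (simp add: Q_alg_def G_def)

abbreviation Q_dual :: "(gen, 'k::field) quadratic"
  where "Q_dual \<equiv> quadratic_dual (Q_alg n E)"

lemma gens_Q_dual [simp]: "gens Q_dual = G"
  by (simp add: quadratic_dual_def)

lemma rels_Q_dual: "rels Q_dual \<subseteq> carrier (free_algebra G)"
  using tensor_power_carrier[of G 2] by (auto simp: quadratic_dual_def)

lemma R_in_rels:
  shows R2_rels: "i \<in> {1..n} \<Longrightarrow> j \<in> {1..n} \<Longrightarrow> i \<noteq> j \<Longrightarrow> R2 E i j \<in> rels (Q_alg n E)"
    and R3_rels: "i \<in> {1..n} \<Longrightarrow> j \<in> {1..n} \<Longrightarrow> k \<in> {1..n} \<Longrightarrow> distinct [i, j, k]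
      \<Longrightarrow> R3 E i j k \<in> rels (Q_alg n E)"
    and R4_rels: "i \<in> {1..n} \<Longrightarrow> j \<in> {1..n} \<Longrightarrow> k \<in> {1..n} \<Longrightarrow> l \<in> {1..n} \<Longrightarrow> distinct [i, j, k, l]
      \<Longrightarrow> R4 E i j k l \<in> rels (Q_alg n E)"
proof -
  show "R2 E i j \<in> rels (Q_alg n E)" if "i \<in> {1..n}" "j \<in> {1..n}" "i \<noteq> j"
    using that by (simp add: Q_alg_def) blast
  show "R3 E i j k \<in> rels (Q_alg n E)" if "i \<in> {1..n}" "j \<in> {1..n}" "k \<in> {1..n}" "distinct [i, j, k]"
    using that by (simp add: Q_alg_def) blast
  show "R4 E i j k l \<in> rels (Q_alg n E)" if "i \<in> {1..n}" "j \<in> {1..n}" "k \<in> {1..n}" "l \<in> {1..n}"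
    "distinct [i, j, k, l]"
    using that by (simp add: Q_alg_def) blast
qed

end

context signed_graph
begin

lemma ue_commute: "ue E i j = ue E j i"
  by (simp add: ue_def insert_commute)

lemma W_insert: "finite T \<Longrightarrow> w \<notin> T \<Longrightarrow> W v (insert w T) = W v T + ue E v w"
  by (simp add: W_def algebra_simps)

text \<open>The left side compares the two orders of adding \<open>u\<close> and \<open>v\<close> to
  a state occupying \<open>T\<close>. It equals the commutator of \<open>W u T\<close> and
  \<open>W v T\<close> minus \<open>ue E u v * (W u T - W v T)\<close>. Terms without
  \<open>T\<close> form \<open>R2\<close>, terms with one \<open>w\<close> form \<open>R3\<close>,
  and commutators with two different members of \<open>T\<close> form \<open>R4\<close>.\<close>

lemma W_commutator:
  assumes "finite T" "u \<notin> T" "v \<notin> T"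
  shows "W u (insert v T) * W v T - W v (insert u T) * W u T
    = R2 E u v + (\<Sum>w\<in>T. R3 E u v w) + (\<Sum>w\<in>T. \<Sum>w'\<in>T - {w}. R4 E u w v w')"
proof -
  define S where "S v = (\<Sum>w\<in>T. ue E v w :: (gen, 'k) falg)" for v
  have WS: "W v T = uv v + S v" for v by (simp add: W_def S_def)
  have "(\<Sum>w\<in>T. R3 E u v w) + (\<Sum>w\<in>T. \<Sum>w'\<in>T - {w}. R4 E u w v w')
    = (\<Sum>w\<in>T. commutator (uv u) (ue E v w)) + (\<Sum>w\<in>T. commutator (ue E u w) (uv v))
      + (\<Sum>w\<in>T. commutator (ue E u w) (ue E v w) + (\<Sum>w'\<in>T - {w}. R4 E u w v w'))
      - ue E u v * (S u - S v)"
    by (simp add: R3_def S_def sum.distrib sum_subtractf sum_distrib_left right_diff_distrib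
        algebra_simps)
  also have "(\<Sum>w\<in>T. commutator (uv u) (ue E v w)) = commutator (uv u) (S v)"
    by (simp add: S_def commutator_sum_right)
  also have "(\<Sum>w\<in>T. commutator (ue E u w) (uv v)) = commutator (S u) (uv v)"
    by (simp add: S_def commutator_sum_left)
  also have "(\<Sum>w\<in>T. commutator (ue E u w) (ue E v w) + (\<Sum>w'\<in>T - {w}. R4 E u w v w'))
    = (\<Sum>w\<in>T. \<Sum>w'\<in>T. commutator (ue E u w) (ue E v w'))"
    using assms(1) by (intro sum.cong) (simp_all add: sum.remove R4_def)
  also have "\<dots> = commutator (S u) (S v)"
    unfolding S_def commutator_sum_left by (simp only: commutator_sum_right)
  finally have eq: "(\<Sum>w\<in>T. R3 E u v w) + (\<Sum>w\<in>T. \<Sum>w'\<in>T - {w}. R4 E u w v w')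
    = commutator (uv u) (S v) + commutator (S u) (uv v) + commutator (S u) (S v)
      - ue E u v * (S u - S v)" .
  show ?thesis
    unfolding add.assoc eq using assms
    by (simp add: W_insert WS R2_def commutator_def ue_commute[of v u] algebra_simps)
qed

lemma sgn_add_square: "sgn_add g X * sgn_add g X = 1"
  by (simp add: sgn_add_def \<sigma>_square flip: prod.distrib)

text \<open>The vertex and the opposite edge have equal signs against \<open>X\<close>, which
  cancel, and the sign between them is 1. Hence the three terms of a triangle enter with the same
  sign, as the definition of \<open>C\<close> requires.\<close>

lemma ins_vertex_edge:
  assumes X: "X \<subseteq> G" and T: "triangle E T" "v \<in> T" "T \<inter> touched X = {}"
  shows "sgn_add (Edge (T - {v})) X * ins c (Vertex v) (insert (Edge (T - {v})) X)
    = c (vertex_edge T v \<union> X)"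
proof -
  have ve: "Vertex v \<in> G" "Edge (T - {v}) \<in> G"
    using vertex_edge_G[OF T(1,2)] by (auto simp: vertex_edge_def)
  have s: "sgn_add (Edge (T - {v})) X = sgn_add (Vertex v) X"
    unfolding sgn_add_def
  proof (rule prod.cong)
    fix h assume h: "h \<in> X"
    have "\<not> supp h \<subseteq> T"
      using h X T(3) supp_touched[OF h] supp_G(2)[of h] by blast
    then show "\<sigma> (Edge (T - {v})) h = \<sigma> (Vertex v) h"
      using T h X ve by (intro \<sigma>_triangle[OF T(1)]) auto
  qed simp
  have "Edge (T - {v}) \<notin> X"
    using T not_in_untouched[OF ve(2), of X] by auto
  then have "sgn_add (Vertex v) (insert (Edge (T - {v})) X) = sgn_add (Vertex v) X"
    using \<sigma>_inside[OF T(1,2)] ve(2) X by (simp add: sgn_add_insert)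
  moreover have "supp (Vertex v) \<inter> touched (insert (Edge (T - {v})) X) = {}"
    using T by auto
  ultimately show ?thesis
    by (simp add: ins_def s sgn_add_square vertex_edge_def flip: mult.assoc)
qed

lemma act_degree_2:
  assumes "f \<in> tensor_power G 2"
  shows "act L c f X = (\<Sum>x\<in>G. \<Sum>y\<in>G. pairing f (generator x * generator y) * L y (L x c) X)"
proof -
  let ?h = "\<lambda>(x, y). Wd [x, y] :: gen fmonoid"
  have "Poly_Mapping.keys f \<subseteq> ?h ` (G \<times> G)"
  proof
    fix w assume "w \<in> Poly_Mapping.keys f"
    with assms have "set (letters w) \<subseteq> G" "length (letters w) = 2"
      by (auto simp: tensor_power_def)
    then obtain x y where "letters w = [x, y]" "x \<in> G" "y \<in> G"
      by (auto simp: length_Suc_conv numeral_2_eq_2)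
    then show "w \<in> ?h ` (G \<times> G)" by (cases w) auto
  qed
  then have "act L c f X = (\<Sum>w\<in>?h ` (G \<times> G). Poly_Mapping.lookup f w * foldl (\<lambda>c x. L x c) c (letters w) X)"
    by (intro act_superset) (simp_all add: finite_G)
  also have "\<dots> = (\<Sum>p\<in>G \<times> G. Poly_Mapping.lookup f (?h p) * foldl (\<lambda>c x. L x c) c (letters (?h p)) X)"
    by (subst sum.reindex) (auto simp: inj_on_def)
  also have "\<dots> = (\<Sum>x\<in>G. \<Sum>y\<in>G. Poly_Mapping.lookup f (Wd [x, y]) * L y (L x c) X)"
    by (simp add: sum.cartesian_product case_prod_unfold)
  finally show ?thesis
    by (simp add: pairing_generators)
qed

text \<open>The second letter of a word acts first on \<open>X\<close>. Sorting words by what their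
  letters add gives vertex-vertex, edge-edge and vertex-edge sums weighted by the antisymmetric
  \<open>D\<close>. So only differences of the two orders matter, and \<open>f\<close> vanishes on
  these as combinations of defining relations, except when a vertex and an edge fill a triangle:
  there \<open>R3\<close> merely equates the three pairings, and \<open>c \<in> C\<close> does the
  rest.\<close>

lemma dual_rels_annihilate:
  assumes f: "f \<in> rels Q_dual" and c: "c \<in> C"
  shows "act L c f = (\<lambda>X. 0)"
proof
  fix X
  have f2: "f \<in> tensor_power G 2" and orth: "\<And>r. r \<in> rels (Q_alg n E) \<Longrightarrow> pairing f r = 0"
    using f by (auto simp: quadratic_dual_def)
  note lf = linear_functional_pairing[of f]
  note [simp] = lf_add[OF lf] lf_diff[OF lf] lf_zero[OF lf] lf_sum[OF lf] lf_uminus[OF lf]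
  have L0: "L y d X = 0" if "\<not> X \<subseteq> G" for y d using that by (cases y) auto
  show "act L c f X = 0"
  proof (cases "X \<subseteq> G")
    case False
    then show ?thesis by (simp add: act_degree_2[OF f2] L0)
  next
    case X: True
    define T where "T = touched X"
    define F where "F = {1..n} - T"
    define E0 where "E0 = {e \<in> E. e \<inter> T = {}}"
    define D where "D h g = sgn_add g X * ins c h (insert g X)" for h g
    let ?e = "\<lambda>e. generator (Edge e) :: (gen, 'k) falg"
    have T: "finite T" "T \<subseteq> {1..n}"
      using finite_touched[OF X] touched_G[OF X] by (auto simp: T_def)
    have E0: "e \<in> E" "e \<inter> T = {}" "e \<subseteq> F" "finite e" if "e \<in> E0" for e
      using that supp_G(1)[of "Edge e"] supp_G(3)[of "Edge e"] by (auto simp: E0_def F_def)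
    have fin: "finite F" "finite E0" by (auto simp: F_def E0_def finite_E)
    have anti: "D h g = - D g h"
      if "g \<in> G" "h \<in> G" "supp g \<inter> T = {}" "supp h \<inter> T = {}" for g h
    proof (cases "supp g \<inter> supp h = {}")
      case True
      then show ?thesis
        unfolding D_def using that X by (intro ins_anticommute) (auto simp: T_def)
    next
      case False
      then show ?thesis by (auto simp: D_def ins_def)
    qed
    have D_touching: "D h g = 0" if "supp g \<inter> supp h \<noteq> {}" for g h
      using that by (auto simp: D_def ins_def)
    have ins_L: "ins (L x c) g X = sgn_add g X * L x c (insert g X)" if "supp g \<inter> T = {}" for x g
      using that by (simp add: ins_def T_def)
    \<comment> \<open>This is \<open>sum_L\<close> at the state \<open>insert g X\<close>. The index
      sets are then enlarged to those of \<open>X\<close>, since \<open>ins\<close> is 0 on a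
      support already touched.\<close>
    have step: "(\<Sum>x\<in>G. pairing f (generator x * p) * ins (L x c) g X)
      = (\<Sum>u\<in>F. pairing f (W u (supp g \<union> T) * p) * D (Vertex u) g)
        + (\<Sum>e\<in>E0. pairing f (?e e * p) * D (Edge e) g)"
      if g: "g \<in> G" "supp g \<inter> T = {}" for g p
    proof -
      have "(\<Sum>x\<in>G. pairing f (generator x * p) * ins (L x c) g X)
        = sgn_add g X * (\<Sum>x\<in>G. pairing f (generator x * p) * L x c (insert g X))"
        using g(2) by (simp add: ins_L sum_distrib_left algebra_simps)
      also have "(\<Sum>x\<in>G. pairing f (generator x * p) * L x c (insert g X))
        = (\<Sum>u\<in>{1..n} - (supp g \<union> T). pairing f (W u (supp g \<union> T) * p) * ins c (Vertex u) (insert g X))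
        + (\<Sum>e | e \<in> E \<and> e \<inter> (supp g \<union> T) = {}. pairing f (?e e * p) * ins c (Edge e) (insert g X))"
        using sum_L[OF linear_functional_mult_right[OF lf, of p], of "insert g X"] X g
        by (simp add: T_def)
      also have "(\<Sum>u\<in>{1..n} - (supp g \<union> T). pairing f (W u (supp g \<union> T) * p) * ins c (Vertex u) (insert g X))
        = (\<Sum>u\<in>F. pairing f (W u (supp g \<union> T) * p) * ins c (Vertex u) (insert g X))"
        by (rule sum.mono_neutral_left) (auto simp: F_def ins_def)
      also have "(\<Sum>e | e \<in> E \<and> e \<inter> (supp g \<union> T) = {}. pairing f (?e e * p) * ins c (Edge e) (insert g X))
        = (\<Sum>e\<in>E0. pairing f (?e e * p) * ins c (Edge e) (insert g X))"
        by (rule sum.mono_neutral_left) (auto simp: E0_def ins_def finite_E)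
      finally show ?thesis
        by (simp add: D_def algebra_simps sum_distrib_left)
    qed
    have "act L c f X = (\<Sum>x\<in>G. (\<Sum>v\<in>F. pairing f (generator x * W v T) * ins (L x c) (Vertex v) X)
        + (\<Sum>e\<in>E0. pairing f (generator x * ?e e) * ins (L x c) (Edge e) X))"
      unfolding act_degree_2[OF f2]
      using sum_L[OF linear_functional_mult_left[OF lf] X] by (simp add: F_def E0_def T_def)
    also have "\<dots> = (\<Sum>v\<in>F. \<Sum>x\<in>G. pairing f (generator x * W v T) * ins (L x c) (Vertex v) X)
        + (\<Sum>e\<in>E0. \<Sum>x\<in>G. pairing f (generator x * ?e e) * ins (L x c) (Edge e) X)"
      by (simp only: sum.distrib sum.swap[of _ G])
    also have "\<dots> = (\<Sum>v\<in>F. (\<Sum>u\<in>F. pairing f (W u (insert v T) * W v T) * D (Vertex u) (Vertex v))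
          + (\<Sum>e\<in>E0. pairing f (?e e * W v T) * D (Edge e) (Vertex v)))
        + (\<Sum>e\<in>E0. (\<Sum>v\<in>F. pairing f (W v (e \<union> T) * ?e e) * D (Vertex v) (Edge e))
          + (\<Sum>e'\<in>E0. pairing f (?e e' * ?e e) * D (Edge e') (Edge e)))"
      by (intro arg_cong2[where f = "(+)"] sum.cong) (auto simp: step F_def E0)
    also have "\<dots> = (\<Sum>v\<in>F. \<Sum>u\<in>F. pairing f (W u (insert v T) * W v T) * D (Vertex u) (Vertex v))
        + (\<Sum>e\<in>E0. \<Sum>e'\<in>E0. pairing f (?e e' * ?e e) * D (Edge e') (Edge e))
        + (\<Sum>e\<in>E0. \<Sum>v\<in>F. pairing f (?e e * W v T) * D (Edge e) (Vertex v)
          + pairing f (W v (e \<union> T) * ?e e) * D (Vertex v) (Edge e))"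
      by (simp add: sum.distrib sum.swap[of _ F E0])
    also have "(\<Sum>v\<in>F. \<Sum>u\<in>F. pairing f (W u (insert v T) * W v T) * D (Vertex u) (Vertex v)) = 0"
    proof (rule sum_symmetric_antisymmetric[OF fin(1)])
      fix u v assume uv: "u \<in> F" "v \<in> F" "u \<noteq> v"
      have "pairing f (W u (insert v T) * W v T - W v (insert u T) * W u T) = 0"
      proof (subst W_commutator)
        show "pairing f (R2 E u v + (\<Sum>w\<in>T. R3 E u v w) + (\<Sum>w\<in>T. \<Sum>w'\<in>T - {w}. R4 E u w v w')) = 0"
        proof -
          have "pairing f (R2 E u v) = 0"
            by (intro orth R2_rels) (use uv in \<open>auto simp: F_def\<close>)
          moreover have "(\<Sum>w\<in>T. pairing f (R3 E u v w)) = 0"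
            by (intro sum.neutral ballI orth R3_rels) (use uv T in \<open>auto simp: F_def\<close>)
          moreover have "(\<Sum>w\<in>T. \<Sum>w'\<in>T - {w}. pairing f (R4 E u w v w')) = 0"
            by (intro sum.neutral ballI orth R4_rels) (use uv T in \<open>auto simp: F_def\<close>)
          ultimately show ?thesis by simp
        qed
      qed (use uv T in \<open>auto simp: F_def\<close>)
      then show "pairing f (W u (insert v T) * W v T) = pairing f (W v (insert u T) * W u T)" by simp
    qed (auto intro!: anti D_touching simp: F_def)
    also have "(\<Sum>e\<in>E0. \<Sum>e'\<in>E0. pairing f (?e e' * ?e e) * D (Edge e') (Edge e)) = 0"
    proof -
      \<comment> \<open>\<open>R4\<close> makes the pairings symmetric for disjoint edges only; for
        the others \<open>D\<close> vanishes, so the coefficient may be set to 0.\<close>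
      let ?a = "\<lambda>e e'. if e \<inter> e' = {} then pairing f (?e e * ?e e') else 0"
      have "(\<Sum>e\<in>E0. \<Sum>e'\<in>E0. pairing f (?e e' * ?e e) * D (Edge e') (Edge e))
        = (\<Sum>e\<in>E0. \<Sum>e'\<in>E0. ?a e' e * D (Edge e') (Edge e))"
        by (intro sum.cong) (auto simp: D_touching Int_commute)
      also have "\<dots> = 0"
      proof (rule sum_symmetric_antisymmetric[OF fin(2)])
        fix e e' assume e: "e \<in> E0" "e' \<in> E0"
        show "?a e e' = ?a e' e"
        proof (cases "e \<inter> e' = {}")
          case True
          obtain i j where ij: "e = {i, j}" "i \<noteq> j" "i \<in> {1..n}" "j \<in> {1..n}"
            using E0(1)[OF e(1)] edgeE by blast
          obtain k l where kl: "e' = {k, l}" "k \<noteq> l" "k \<in> {1..n}" "l \<in> {1..n}"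
            using E0(1)[OF e(2)] edgeE by blast
          have "pairing f (R4 E i j k l) = 0"
            by (intro orth R4_rels) (use ij kl True in auto)
          then show ?thesis
            using True E0(1)[OF e(1)] E0(1)[OF e(2)] ij(1) kl(1)
            by (simp add: R4_def commutator_def ue_def Int_commute)
        qed (auto simp: Int_commute)
        show "D (Edge e) (Edge e') = - D (Edge e') (Edge e)"
          using e E0 by (intro anti) auto
      next
        fix e assume "e \<in> E0"
        then show "D (Edge e) (Edge e) = 0"
          using supp_G(2)[of "Edge e"] E0(1) by (intro D_touching) auto
      qed
      finally show ?thesis .
    qed
    also have "(\<Sum>e\<in>E0. \<Sum>v\<in>F. pairing f (?e e * W v T) * D (Edge e) (Vertex v)
          + pairing f (W v (e \<union> T) * ?e e) * D (Vertex v) (Edge e)) = 0"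
    proof -
      \<comment> \<open>The edge added before the vertex, minus the vertex added before the edge.
        Its dependence on \<open>T\<close> consists of \<open>R4\<close> terms and disappears
        next.\<close>
      define \<theta> where "\<theta> v e = pairing f (W v (e \<union> T) * ?e e - ?e e * W v T)" for v e
      have \<theta>: "\<theta> v {j, k} = pairing f (commutator (uv v) (ue E j k) + ue E v j * ue E j k + ue E v k * ue E j k)"
        if v: "v \<in> F" "{j, k} \<in> E0" "v \<notin> {j, k}" for v j k
      proof -
        have jk: "j \<noteq> k" "j \<in> F" "k \<in> F" "?e {j, k} = ue E j k"
          using E0[OF v(2)] by (auto simp: ue_def elim: edgeE)
        have "W v ({j, k} \<union> T) = W v T + ue E v j + ue E v k"
          using T jk by (simp add: W_insert F_def algebra_simps)
        then have "\<theta> v {j, k} = pairing f (commutator (uv v) (ue E j k) + ue E v j * ue E j k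
            + ue E v k * ue E j k + (\<Sum>w\<in>T. R4 E v w j k))"
          unfolding \<theta>_def jk(4)
          by (simp add: W_def R4_def commutator_def algebra_simps sum_distrib_left sum_distrib_right
              sum_subtractf)
        also have "pairing f (\<Sum>w\<in>T. R4 E v w j k) = 0"
          unfolding lf_sum[OF lf]
          by (intro sum.neutral ballI orth R4_rels) (use jk v T in \<open>auto simp: F_def\<close>)
        then have "pairing f (commutator (uv v) (ue E j k) + ue E v j * ue E j k
            + ue E v k * ue E j k + (\<Sum>w\<in>T. R4 E v w j k))
          = pairing f (commutator (uv v) (ue E j k) + ue E v j * ue E j k + ue E v k * ue E j k)"
          by simp
        finally show ?thesis .
      qed
      have \<theta>_triangle: "\<theta> i (S - {i}) = \<theta> j (S - {j})"
        if S: "triangle E S" "S \<inter> T = {}" "i \<in> S" "j \<in> S" for S i j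
      proof (cases "i = j")
        case False
        have "card (S - {i, j}) = 1"
          using S False triangle_card[OF S(1)] by (simp add: card_Diff_subset)
        then obtain k where k: "S - {i, j} = {k}" by (auto simp: card_1_singleton_iff)
        have ijk: "distinct [i, j, k]" "S - {i} = {j, k}" "S - {j} = {i, k}"
          using k S False by auto
        have SF: "S \<subseteq> F" using triangle_le[OF S(1)] S(2) by (auto simp: F_def)
        have "S - {i} \<in> E0" "S - {j} \<in> E0"
          using triangle_edge[OF S(1) S(3)] triangle_edge[OF S(1) S(4)] S(2) by (auto simp: E0_def)
        then have E0': "{j, k} \<in> E0" "{i, k} \<in> E0"
          unfolding ijk(2,3) .
        have "k \<in> S" using k by blast
        with S SF have mem: "i \<in> F" "j \<in> F" "k \<in> F" by blast+
        have neq: "i \<notin> {j, k}" "j \<notin> {i, k}" using ijk(1) by auto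
        \<comment> \<open>The arguments of the two values of \<theta> differ exactly by
          \<open>R3 E i j k\<close>.\<close>
        have "pairing f (R3 E i j k) = 0"
          by (intro orth R3_rels ijk(1)) (use mem in \<open>auto simp: F_def\<close>)
        then show ?thesis
          unfolding ijk(2,3) \<theta>[OF mem(1) E0'(1) neq(1)] \<theta>[OF mem(2) E0'(2) neq(2)]
          by (simp add: R3_def commutator_def algebra_simps ue_commute[of j i])
      qed simp
      have \<theta>_zero: "\<theta> v e = 0" if v: "v \<in> F" "e \<in> E0" "v \<notin> e" "\<not> triangle E (insert v e)" for v e
      proof -
        obtain j k where jk: "e = {j, k}" "j \<noteq> k" "j \<in> {1..n}" "k \<in> {1..n}"
          using E0(1)[OF v(2)] by (auto elim: edgeE)
        have "{j, k} \<in> E" using E0(1)[OF v(2)] jk by simp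
        then have cases: "{v, j} \<notin> E \<or> {v, k} \<notin> E"
          using v(3,4) jk unfolding triangle_def by blast
        have d: "distinct [v, k, j]" "distinct [v, j, k]" "v \<in> {1..n}" "v \<notin> {j, k}"
          using jk(1,2) v(1,3) by (auto simp: F_def)
        \<comment> \<open>If \<open>v\<close> is not joined to \<open>j\<close>, then
          \<open>R3 E v k j\<close> collapses to the argument of \<theta>; if it is not joined to
          \<open>k\<close>, then \<open>R3 E v j k\<close> does.\<close>
        have "pairing f (R3 E v k j) = 0" "pairing f (R3 E v j k) = 0"
          using d jk(3,4) by (blast intro: orth R3_rels)+
        then show ?thesis
          unfolding jk(1) \<theta>[OF v(1) v(2)[unfolded jk(1)] d(4)] using cases
          by (auto simp: R3_def ue_commute[of k j] ue_def[of E v j] ue_def[of E v k] commutator_def)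
      qed
      have "(\<Sum>e\<in>E0. \<Sum>v\<in>F. pairing f (?e e * W v T) * D (Edge e) (Vertex v)
          + pairing f (W v (e \<union> T) * ?e e) * D (Vertex v) (Edge e))
        = (\<Sum>e\<in>E0. \<Sum>v\<in>F. \<theta> v e * D (Vertex v) (Edge e))"
      proof (intro sum.cong refl)
        fix e v assume "e \<in> E0" "v \<in> F"
        then have "D (Edge e) (Vertex v) = - D (Vertex v) (Edge e)"
          using E0 by (intro anti) (auto simp: F_def)
        then show "pairing f (?e e * W v T) * D (Edge e) (Vertex v)
            + pairing f (W v (e \<union> T) * ?e e) * D (Vertex v) (Edge e) = \<theta> v e * D (Vertex v) (Edge e)"
          by (simp add: \<theta>_def algebra_simps)
      qed
      also have "\<dots> = (\<Sum>(e, v)\<in>E0 \<times> F. \<theta> v e * D (Vertex v) (Edge e))"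
        by (rule sum.cartesian_product)
      also have "\<dots> = (\<Sum>(e, v)\<in>{(e, v) \<in> E0 \<times> F. v \<notin> e \<and> triangle E (insert v e)}. \<theta> v e * D (Vertex v) (Edge e))"
        using fin \<theta>_zero D_touching[of "Edge _" "Vertex _"]
        by (intro sum.mono_neutral_right) fastforce+
      also have "\<dots> = (\<Sum>(S, v)\<in>Sigma {S. triangle E S \<and> S \<inter> T = {}} (\<lambda>S. S).
          \<theta> v (S - {v}) * D (Vertex v) (Edge (S - {v})))"
      proof (rule sum.reindex_bij_witness[of _ "\<lambda>(S, v). (S - {v}, v)" "\<lambda>(e, v). (insert v e, v)"])
        fix p assume "p \<in> Sigma {S. triangle E S \<and> S \<inter> T = {}} (\<lambda>S. S)"
        then obtain S v where p: "p = (S, v)" and S: "triangle E S" "S \<inter> T = {}" "v \<in> S" by auto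
        have "S - {v} \<in> E0" "v \<in> F"
          using S triangle_edge[OF S(1,3)] triangle_le[OF S(1)] by (auto simp: E0_def F_def)
        then show "(case p of (S, v) \<Rightarrow> (S - {v}, v))
          \<in> {(e, v) \<in> E0 \<times> F. v \<notin> e \<and> triangle E (insert v e)}"
          using S by (simp add: p insert_absorb)
      qed (auto simp: E0_def F_def insert_absorb)
      also have "\<dots> = (\<Sum>S | triangle E S \<and> S \<inter> T = {}. \<Sum>v\<in>S. \<theta> v (S - {v}) * D (Vertex v) (Edge (S - {v})))"
        by (rule sum.Sigma[symmetric])
          (auto intro: finite_subset[OF _ finite_triangles] triangle_finite)
      also have "\<dots> = 0"
      proof (rule sum.neutral, clarify)
        fix S assume S: "triangle E S" "S \<inter> T = {}"
        then obtain w where w: "w \<in> S" using triangle_card[OF S(1)] by fastforce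
        \<comment> \<open>On a triangle \<theta> is constant and \<open>D\<close> is the plain value
          of \<open>c\<close>, so the sum is a multiple of the one that vanishes for
          \<open>c \<in> C\<close>.\<close>
        have "(\<Sum>v\<in>S. \<theta> v (S - {v}) * D (Vertex v) (Edge (S - {v})))
          = (\<Sum>v\<in>S. \<theta> w (S - {w}) * c (vertex_edge S v \<union> X))"
          using S w by (intro sum.cong refl arg_cong2[where f = "(*)"] \<theta>_triangle)
            (auto simp: D_def T_def ins_vertex_edge[OF X])
        also have "\<dots> = \<theta> w (S - {w}) * (\<Sum>v\<in>S. c (vertex_edge S v \<union> X))"
          by (simp add: sum_distrib_left)
        also have "(\<Sum>v\<in>S. c (vertex_edge S v \<union> X)) = 0"
          using c S X unfolding C_def T_def by blast
        finally show "(\<Sum>v\<in>S. \<theta> v (S - {v}) * D (Vertex v) (Edge (S - {v}))) = 0" by simp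
      qed
      finally show ?thesis .
    qed
    finally show ?thesis by simp
  qed
qed

end

section \<open>Linear independence\<close>

context graph_no_overlap
begin

definition states :: "gen set set"
  where "states = {X. X \<subseteq> G \<and> (\<forall>g\<in>X. \<forall>h\<in>X. g \<noteq> h \<longrightarrow> supp g \<inter> supp h = {})}"

text \<open>The product to be dropped for the triangle \<open>T\<close>; \<open>Max\<close> serves
  only to make the choice definite.\<close>

definition bad :: "nat set \<Rightarrow> gen set"
  where "bad T = vertex_edge T (Max T)"

definition good :: "gen set set"
  where "good = {X \<in> states. \<forall>T. triangle E T \<longrightarrow> \<not> bad T \<subseteq> X}"

definition inside :: "nat set \<Rightarrow> gen set"
  where "inside T = {g \<in> G. supp g \<subseteq> T}"

lemma Max_triangle: "triangle E T \<Longrightarrow> Max T \<in> T"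
  using triangle_card[of T] triangle_finite[of T] by (intro Max_in) auto

lemma vertex_edge_inside: "triangle E T \<Longrightarrow> v \<in> T \<Longrightarrow> vertex_edge T v \<subseteq> inside T"
  using vertex_edge_G by (auto simp: inside_def vertex_edge_def)

lemma bad_inside: "triangle E T \<Longrightarrow> bad T \<subseteq> inside T"
  unfolding bad_def using vertex_edge_inside Max_triangle by blast

text \<open>Supports are nonempty, so a common generator would give a common vertex. This lets the
  reductions in different triangles be made independently.\<close>

lemma inside_disjoint:
  assumes "triangle E S" "triangle E T" "S \<noteq> T" shows "inside S \<inter> inside T = {}"
proof -
  have False if g: "g \<in> G" "supp g \<subseteq> S" "supp g \<subseteq> T" for g
  proof -
    obtain w where "w \<in> supp g" using supp_G(2)[OF g(1)] by blast
    then show False using g(2,3) triangle_disjoint[OF assms] by blast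
  qed
  then show ?thesis by (auto simp: inside_def)
qed

lemma vertex_edge_eq_iff [simp]: "vertex_edge T v = vertex_edge T w \<longleftrightarrow> v = w"
proof
  assume "vertex_edge T v = vertex_edge T w"
  moreover have "Vertex v \<in> vertex_edge T v" by (simp add: vertex_edge_def)
  ultimately have "Vertex v \<in> vertex_edge T w" by (rule subst)
  then show "v = w" by (simp add: vertex_edge_def)
qed simp

lemma goodD: "X \<in> good \<Longrightarrow> X \<in> states" and statesD: "X \<in> states \<Longrightarrow> X \<subseteq> G"
  by (auto simp: good_def states_def)

text \<open>Generators are compared first by a representative shared by all generators inside one
  triangle, then vertices before edges, then by an arbitrary numbering; \<sigma> is 1 if the first
  argument is smaller. Seen from outside a triangle is one block, and inside it vertices precede
  edges. Since no generator lies inside two triangles, the least vertex of its triangle is a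
  well-defined representative.\<close>

lemma ex_signs:
  obtains \<sigma> :: "gen \<Rightarrow> gen \<Rightarrow> 'k::field" where "signed_graph n E \<sigma>"
proof -
  obtain idx :: "gen \<Rightarrow> nat" where idx: "inj_on idx G"
    using finite_imp_inj_to_nat_seg[OF finite_G] by blast
  define rep where "rep g = (if \<exists>T. triangle E T \<and> supp g \<subseteq> T
    then Vertex (Min (THE T. triangle E T \<and> supp g \<subseteq> T)) else g)" for g
  define vert where "vert g \<longleftrightarrow> (\<exists>v. g = Vertex v)" for g
  define lt where "lt g h \<longleftrightarrow> idx (rep g) < idx (rep h) \<or> idx (rep g) = idx (rep h) \<and>
    (vert g \<and> \<not> vert h \<or> (vert g \<longleftrightarrow> vert h) \<and> idx g < idx h)" for g h
  have Min_in: "Min T \<in> T" if "triangle E T" for T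
    using triangle_card[OF that] triangle_finite[OF that] by (intro Min_in) auto
  have rep: "rep g = Vertex (Min T)" if r: "triangle E T" "g \<in> G" "supp g \<subseteq> T" for g T
  proof -
    obtain w where w: "w \<in> supp g" using supp_G(2)[OF r(2)] by blast
    have "(THE T. triangle E T \<and> supp g \<subseteq> T) = T"
    proof (rule the_equality)
      fix S assume S: "triangle E S \<and> supp g \<subseteq> S"
      then have "w \<in> S \<inter> T" using w that(3) by blast
      then show "S = T" using triangle_disjoint[of S T] S that(1) by blast
    qed (use that in simp)
    moreover have "\<exists>T. triangle E T \<and> supp g \<subseteq> T" using that by blast
    ultimately show ?thesis by (simp add: rep_def)
  qed
  have Min_G: "Vertex (Min T) \<in> G" if "triangle E T" for T
    using Min_in[OF that] triangle_le[OF that] by auto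
  have rep_G: "rep g \<in> G" if "g \<in> G" for g
  proof (cases "\<exists>T. triangle E T \<and> supp g \<subseteq> T")
    case True
    then show ?thesis using rep that Min_G by metis
  next
    case False
    then have "rep g = g" unfolding rep_def by (rule if_not_P)
    then show ?thesis using that by simp
  qed
  \<comment> \<open>A generator not inside \<open>T\<close> is represented by a vertex of a triangle
    disjoint from \<open>T\<close>, or by itself.\<close>
  have rep_outside: "idx (rep h) \<noteq> idx (Vertex (Min T))"
    if "triangle E T" "h \<in> G" "\<not> supp h \<subseteq> T" for h T
  proof -
    have "rep h \<noteq> Vertex (Min T)"
    proof (cases "\<exists>S. triangle E S \<and> supp h \<subseteq> S")
      case True
      then obtain S where S: "triangle E S" "supp h \<subseteq> S" by blast
      then have "S \<inter> T = {}" using that triangle_disjoint by blast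
      then show ?thesis using rep[OF S(1) that(2) S(2)] Min_in[OF S(1)] Min_in[OF that(1)] by auto
    next
      case False
      then have "rep h = h" unfolding rep_def by (rule if_not_P)
      then show ?thesis using that Min_in[OF that(1)] by auto
    qed
    then show ?thesis
      using idx rep_G[OF that(2)] Min_G[OF that(1)] by (auto dest: inj_onD)
  qed
  define \<sigma> :: "gen \<Rightarrow> gen \<Rightarrow> 'k" where "\<sigma> g h = (if lt g h then 1 else - 1)" for g h
  have "signed_graph n E \<sigma>"
  proof unfold_locales
    fix g h assume "g \<in> G" "h \<in> G" "g \<noteq> h"
    then have "idx g \<noteq> idx h" using idx by (auto dest: inj_onD)
    then have "lt g h \<longleftrightarrow> \<not> lt h g" by (auto simp: lt_def)
    then show "\<sigma> g h = - \<sigma> h g" by (simp add: \<sigma>_def)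
  next
    fix T g g' h
    assume T: "triangle E T" "g \<in> G" "g' \<in> G" "h \<in> G" "supp g \<subseteq> T" "supp g' \<subseteq> T" "\<not> supp h \<subseteq> T"
    then have "lt g h \<longleftrightarrow> lt g' h"
      using rep_outside[of T h] by (auto simp: lt_def rep)
    then show "\<sigma> g h = \<sigma> g' h" by (simp add: \<sigma>_def)
  next
    fix T v e assume T: "triangle E T" "v \<in> T" "e \<in> E" "e \<subseteq> T"
    then have "rep (Vertex v) = rep (Edge e)"
      using rep[OF T(1), of "Vertex v"] rep[OF T(1), of "Edge e"] triangle_le[OF T(1)] by auto
    then show "\<sigma> (Vertex v) (Edge e) = 1" by (simp add: \<sigma>_def lt_def vert_def)
  qed (simp add: \<sigma>_def)
  then show ?thesis by (rule that)
qed

end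

context signed_graph
begin

text \<open>The product \<open>bad T\<close> is minus the sum of the other two vertex-edge products in \<open>T\<close>.\<close>

definition local_coeff :: "nat set \<Rightarrow> gen set \<Rightarrow> gen set \<Rightarrow> 'k"
  where "local_coeff T y z =
    (if y = z then 1 else if z = bad T \<and> y \<in> vertex_edge T ` T then - 1 else 0)"

definition outside :: "gen set \<Rightarrow> gen set"
  where "outside X = X - (\<Union>T\<in>{T. triangle E T}. inside T)"

text \<open>For good \<open>Y\<close> this is the coefficient of \<open>Y\<close> after every bad
  pair in \<open>Z\<close> has been rewritten. It factors over the triangles because they share no
  generators.\<close>

definition dual_basis :: "gen set \<Rightarrow> gen set \<Rightarrow> 'k"
  where "dual_basis Y Z = (if outside Z = outside Y
    then \<Prod>T | triangle E T. local_coeff T (Y \<inter> inside T) (Z \<inter> inside T) else 0)"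

text \<open>If \<open>y\<close> is the pair of a vertex \<open>w\<close>, then \<open>w\<close>
  differs from \<open>Max T\<close>; \<open>w\<close> contributes 1 and \<open>Max T\<close>
  contributes -1. Otherwise all terms are 0.\<close>

lemma sum_local_coeff:
  assumes T: "triangle E T" and y: "y \<noteq> bad T"
  shows "(\<Sum>v\<in>T. local_coeff T y (vertex_edge T v)) = 0"
proof (cases "y \<in> vertex_edge T ` T")
  case True
  then obtain w where w: "w \<in> T" "y = vertex_edge T w" by blast
  have "(\<Sum>v\<in>T. local_coeff T y (vertex_edge T v))
    = (\<Sum>v\<in>T. (if v = w then 1 else 0) + (if v = Max T then - 1 else 0))"
    using w y by (intro sum.cong) (auto simp: local_coeff_def bad_def)
  also have "\<dots> = 0"
    using w Max_triangle[OF T] triangle_finite[OF T] by (simp add: sum.distrib)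
  finally show ?thesis .
qed (auto simp: local_coeff_def intro!: sum.neutral)

lemma dual_basis_C:
  assumes Y: "Y \<in> good" shows "dual_basis Y \<in> C"
  unfolding C_def
proof (intro CollectI allI impI)
  fix X T assume X: "X \<subseteq> G" "triangle E T" "T \<inter> touched X = {}"
  let ?Z = "\<lambda>v. vertex_edge T v \<union> X"
  have T: "X \<inter> inside T = {}"
    using X supp_touched[of _ X] supp_G(2) by (fastforce simp: inside_def)
  have out: "outside (?Z v) = outside X" if "v \<in> T" for v
    using vertex_edge_inside[OF X(2) that] X(2) by (auto simp: outside_def)
  have in_T: "?Z v \<inter> inside T = vertex_edge T v" if "v \<in> T" for v
    using vertex_edge_inside[OF X(2) that] T by auto
  have in_S: "?Z v \<inter> inside S = X \<inter> inside S" if "v \<in> T" "triangle E S" "S \<noteq> T" for v S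
    using vertex_edge_inside[OF X(2) that(1)] inside_disjoint[OF that(2) X(2) that(3)] by auto
  have "Y \<inter> inside T \<noteq> bad T"
    using Y X(2) by (auto simp: good_def)
  note zero = sum_local_coeff[OF X(2) this]
  \<comment> \<open>The part of the coefficient that does not depend on \<open>v\<close>: the
    generators outside all triangles and the factors of the other triangles.\<close>
  define q where "q = (if outside X = outside Y then \<Prod>S\<in>{T. triangle E T} - {T}.
    local_coeff S (Y \<inter> inside S) (X \<inter> inside S) else 0)"
  have "(\<Sum>v\<in>T. dual_basis Y (?Z v)) = (\<Sum>v\<in>T. local_coeff T (Y \<inter> inside T) (vertex_edge T v) * q)"
  proof (rule sum.cong)
    fix v assume v: "v \<in> T"
    have "(\<Prod>S | triangle E S. local_coeff S (Y \<inter> inside S) (?Z v \<inter> inside S))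
      = local_coeff T (Y \<inter> inside T) (?Z v \<inter> inside T)
        * (\<Prod>S\<in>{T. triangle E T} - {T}. local_coeff S (Y \<inter> inside S) (?Z v \<inter> inside S))"
      using X(2) by (intro prod.remove finite_triangles) simp
    also have "(\<Prod>S\<in>{T. triangle E T} - {T}. local_coeff S (Y \<inter> inside S) (?Z v \<inter> inside S))
      = (\<Prod>S\<in>{T. triangle E T} - {T}. local_coeff S (Y \<inter> inside S) (X \<inter> inside S))"
      using in_S[OF v] by (intro prod.cong) auto
    finally show "dual_basis Y (?Z v) = local_coeff T (Y \<inter> inside T) (vertex_edge T v) * q"
      using out[OF v] in_T[OF v] by (simp add: dual_basis_def q_def)
  qed simp
  also have "\<dots> = 0" using zero by (simp flip: sum_distrib_right)
  finally show "(\<Sum>v\<in>T. dual_basis Y (?Z v)) = 0" .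
qed

lemma dual_basis_same: "dual_basis Y Y = 1"
  by (simp add: dual_basis_def local_coeff_def)

text \<open>A good \<open>Z\<close> contains no bad pair, so each local coefficient is a Kronecker
  delta.\<close>

lemma dual_basis_other:
  assumes Y: "Y \<in> good" and Z: "Z \<in> good" and neq: "Z \<noteq> Y"
  shows "dual_basis Y Z = 0"
proof (rule ccontr)
  assume nz: "dual_basis Y Z \<noteq> 0"
  then have out: "outside Z = outside Y" by (auto simp: dual_basis_def split: if_splits)
  have "Y \<inter> inside T = Z \<inter> inside T" if T: "triangle E T" for T
  proof -
    have "local_coeff T (Y \<inter> inside T) (Z \<inter> inside T) \<noteq> 0"
      using nz T finite_triangles by (auto simp: dual_basis_def split: if_splits)
    moreover have "Z \<inter> inside T \<noteq> bad T"
      using Z T by (auto simp: good_def)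
    ultimately show ?thesis by (auto simp: local_coeff_def split: if_splits)
  qed
  with out have "Z = Y" unfolding outside_def by blast
  with neq show False by simp
qed

lemma L_untouched:
  "X \<subseteq> G \<Longrightarrow> supp x \<inter> touched X = {} \<Longrightarrow> L x c X = sgn_add x X * c (insert x X)"
  by (cases x) (auto simp: ins_def)

text \<open>The sign is left unspecified, since only its being nonzero and independent of
  \<open>c\<close> matters. The induction removes the last letter because that one acts on
  \<open>Z\<close> itself.\<close>

lemma foldl_state:
  assumes "distinct xs" "set xs \<inter> Z = {}" "set xs \<union> Z \<in> states"
  shows "\<exists>s. s * s = 1 \<and> (\<forall>c. foldl (\<lambda>c x. L x c) c xs Z = s * c (set xs \<union> Z))"
  using assms
proof (induction xs arbitrary: Z rule: rev_induct)
  case Nil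
  then show ?case by (intro exI[of _ 1]) simp
next
  case (snoc x xs)
  from snoc.prems have "distinct xs" "set xs \<inter> insert x Z = {}" "set xs \<union> insert x Z \<in> states"
    by auto
  from snoc.IH[OF this] obtain s where s: "s * s = 1"
    "\<And>c. foldl (\<lambda>c x. L x c) c xs (insert x Z) = s * c (set xs \<union> insert x Z)" by blast
  have Z: "Z \<subseteq> G" "supp x \<inter> touched Z = {}"
    using snoc.prems by (auto simp: states_def touched_def)
  show ?case
  proof (intro exI[of _ "sgn_add x Z * s"] conjI allI)
    have "sgn_add x Z * s * (sgn_add x Z * s) = (sgn_add x Z * sgn_add x Z) * (s * s)"
      by (simp add: algebra_simps)
    then show "sgn_add x Z * s * (sgn_add x Z * s) = 1" by (simp add: sgn_add_square s(1))
  qed (simp add: L_untouched[OF Z] s(2))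
qed

lemma act_dual_ideal:
  assumes "f \<in> relation_ideal Q_dual" "c \<in> C"
  shows "act L c f = (\<lambda>X. 0)"
proof (rule act_relation_ideal[where C = C and A = Q_dual])
  show "rels Q_dual \<subseteq> carrier (free_algebra (gens Q_dual))"
    unfolding gens_Q_dual by (rule rels_Q_dual)
qed (use assms dual_rels_annihilate L_C in \<open>auto simp: C_def sum.distrib simp flip: sum_distrib_left\<close>)

text \<open>The functional reads off the coordinate of \<open>Y\<close> in the result of letting an
  element act on the empty state. Words are determined by their states only up to sign, hence the
  equivalence in place of a value.\<close>

lemma ex_dual_functional:
  assumes "Y \<in> good"
  shows "\<exists>\<phi> :: (gen, 'k) falg \<Rightarrow> 'k. linear_functional \<phi>
    \<and> (\<forall>f\<in>relation_ideal Q_dual. \<phi> f = 0)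
    \<and> (\<forall>xs. distinct xs \<longrightarrow> set xs \<in> good \<longrightarrow> (\<phi> (monomial xs) = 0 \<longleftrightarrow> set xs \<noteq> Y))"
proof (intro exI[of _ "\<lambda>f. act L (dual_basis Y) f {}"] conjI allI impI ballI)
  show "linear_functional (\<lambda>f. act L (dual_basis Y) f {})"
    by (rule linear_functional_act)
  show "act L (dual_basis Y) f {} = 0" if "f \<in> relation_ideal Q_dual" for f
    by (simp add: act_dual_ideal[OF that dual_basis_C[OF assms]])
  fix xs assume xs: "distinct xs" "set xs \<in> good"
  then obtain s where s: "s * s = 1"
    "foldl (\<lambda>c x. L x c) (dual_basis Y) xs {} = s * dual_basis Y (set xs)"
    using foldl_state[of xs "{}"] goodD by fastforce
  then have "s \<noteq> 0" by auto
  then show "act L (dual_basis Y) (monomial xs) {} = 0 \<longleftrightarrow> set xs \<noteq> Y"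
    using dual_basis_other[OF assms xs(2)] dual_basis_same by (auto simp: act_monomial s(2))
qed

end

section \<open>Spanning\<close>

lemma pairing_commute: "pairing f g = pairing g f"
proof -
  let ?S = "Poly_Mapping.keys f \<union> Poly_Mapping.keys g"
  have "pairing f g = (\<Sum>w\<in>?S. Poly_Mapping.lookup f w * Poly_Mapping.lookup g w)"
    unfolding pairing_def by (intro sum.mono_neutral_left) (auto simp: in_keys_iff)
  moreover have "pairing g f = (\<Sum>w\<in>?S. Poly_Mapping.lookup g w * Poly_Mapping.lookup f w)"
    unfolding pairing_def by (intro sum.mono_neutral_left) (auto simp: in_keys_iff)
  ultimately show ?thesis by (simp add: mult.commute)
qed

section \<open>Coefficients of the defining relations\<close>

lemma lookup_generators:
  fixes a b x y :: 'x
  shows "Poly_Mapping.lookup (generator a * generator b) (Wd [x, y]) = (of_bool (a = x \<and> b = y) :: 'k::field)"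
proof -
  have "generator a * generator b = (monomial [a, b] :: ('x, 'k) falg)"
    by (simp add: monomial_Cons monomial_Nil)
  then show ?thesis by (simp add: monomial_def lookup_single when_def)
qed

lemma lookup_uv_ue:
  "Poly_Mapping.lookup (uv i * uv j) (Wd [x, y]) = of_bool (x = Vertex i \<and> y = Vertex j)"
  "Poly_Mapping.lookup (uv i * ue E j k) (Wd [x, y]) = of_bool (x = Vertex i \<and> y = Edge {j, k} \<and> {j, k} \<in> E)"
  "Poly_Mapping.lookup (ue E j k * uv i) (Wd [x, y]) = of_bool (x = Edge {j, k} \<and> {j, k} \<in> E \<and> y = Vertex i)"
  "Poly_Mapping.lookup (ue E i j * ue E k l) (Wd [x, y]) =
     of_bool (x = Edge {i, j} \<and> {i, j} \<in> E \<and> y = Edge {k, l} \<and> {k, l} \<in> E)"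
  by (auto simp: uv_def ue_def lookup_generators)

lemma lookup_R2:
  "Poly_Mapping.lookup (R2 E i j) (Wd [x, y]) = 
    of_bool (x = Vertex i \<and> y = Vertex j) - of_bool (x = Vertex j \<and> y = Vertex i)
    - of_bool (x = Edge {i, j} \<and> {i, j} \<in> E \<and> y = Vertex i)
    + of_bool (x = Edge {i, j} \<and> {i, j} \<in> E \<and> y = Vertex j)"
  by (simp add: R2_def commutator_def right_diff_distrib lookup_minus lookup_uv_ue)

lemma lookup_R3:
  "Poly_Mapping.lookup (R3 E i j k) (Wd [x, y]) =
    of_bool (x = Vertex i \<and> y = Edge {j, k} \<and> {j, k} \<in> E)
    - of_bool (x = Edge {j, k} \<and> {j, k} \<in> E \<and> y = Vertex i)
    + of_bool (x = Edge {i, k} \<and> {i, k} \<in> E \<and> y = Vertex j)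
    - of_bool (x = Vertex j \<and> y = Edge {i, k} \<and> {i, k} \<in> E)
    + of_bool (x = Edge {i, k} \<and> {i, k} \<in> E \<and> y = Edge {j, k} \<and> {j, k} \<in> E)
    - of_bool (x = Edge {j, k} \<and> {j, k} \<in> E \<and> y = Edge {i, k} \<and> {i, k} \<in> E)
    - of_bool (x = Edge {i, j} \<and> {i, j} \<in> E \<and> y = Edge {i, k} \<and> {i, k} \<in> E)
    + of_bool (x = Edge {i, j} \<and> {i, j} \<in> E \<and> y = Edge {j, k} \<and> {j, k} \<in> E)"
  by (simp add: R3_def commutator_def right_diff_distrib lookup_minus lookup_add lookup_uv_ue)

lemma lookup_R4:
  "Poly_Mapping.lookup (R4 E i j k l) (Wd [x, y]) =
    of_bool (x = Edge {i, j} \<and> {i, j} \<in> E \<and> y = Edge {k, l} \<and> {k, l} \<in> E)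
    - of_bool (x = Edge {k, l} \<and> {k, l} \<in> E \<and> y = Edge {i, j} \<and> {i, j} \<in> E)"
  by (simp add: R4_def commutator_def lookup_minus lookup_uv_ue)

context graph_no_overlap
begin

lemma edge_otherE:
  assumes "e \<in> E" "u \<in> e"
  obtains w where "e = {u, w}" "u \<noteq> w" "w \<in> {1..n}"
proof -
  obtain i j where ij: "e = {i, j}" "i \<noteq> j" "i \<in> {1..n}" "j \<in> {1..n}"
    using assms(1) by (rule edgeE)
  then consider "u = i" | "u = j" using assms(2) by blast
  then show ?thesis
  proof cases
    case 1
    then show ?thesis using that[of j] ij by simp
  next
    case 2
    then show ?thesis using that[of i] ij by (simp add: insert_commute)
  qed
qed

lemma relsE:
  assumes "r \<in> rels (Q_alg n E)"
  obtains (R2) i j where "i \<noteq> j" "r = R2 E i j"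
  | (R3) i j k where "i \<noteq> j" "j \<noteq> k" "i \<noteq> k" "r = R3 E i j k"
  | (R4) i j k l where "i \<noteq> j" "i \<noteq> k" "i \<noteq> l" "j \<noteq> k" "j \<noteq> l" "k \<noteq> l" "r = R4 E i j k l"
  using assms by (auto simp: Q_alg_def)

section \<open>Quadratic relations that hold in the dual algebra\<close>

lemma ideal_Q_dual: "ideal (relation_ideal Q_dual :: (gen, 'k::field) falg set) (free_algebra G)"
proof -
  interpret F: ring "free_algebra G :: (gen, 'k) falg ring" by (rule free_algebra_ring)
  show ?thesis
    unfolding relation_ideal_def gens_Q_dual by (rule F.genideal_ideal[OF rels_Q_dual])
qed

lemma orthogonal_in_ideal:
  assumes f: "f \<in> tensor_power G 2" and orth: "\<And>r. r \<in> rels (Q_alg n E) \<Longrightarrow> pairing r f = 0"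
  shows "f \<in> relation_ideal (Q_dual :: (gen, 'k::field) quadratic)"
proof -
  interpret F: ring "free_algebra G :: (gen, 'k) falg ring" by (rule free_algebra_ring)
  have "f \<in> rels Q_dual" using f orth by (simp add: quadratic_dual_def pairing_commute)
  then show ?thesis
    unfolding relation_ideal_def gens_Q_dual using F.genideal_self[OF rels_Q_dual] by blast
qed

lemma generators_tensor_power:
  "x \<in> G \<Longrightarrow> y \<in> G \<Longrightarrow> generator x * generator y \<in> tensor_power G 2"
  using monomial_tensor_power[of "[x, y]" G 2] by (simp add: monomial_Cons monomial_Nil)

lemma lookup_R3_disjoint:
  assumes "e \<inter> f = {}" shows "Poly_Mapping.lookup (R3 E i j k) (Wd [Edge e, Edge f]) = 0"
proof -
  have "e = {i, k} \<Longrightarrow> f \<noteq> {j, k}" "e = {j, k} \<Longrightarrow> f \<noteq> {i, k}"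
    "e = {i, j} \<Longrightarrow> f \<noteq> {i, k}" "e = {i, j} \<Longrightarrow> f \<noteq> {j, k}"
    using assms by auto
  then show ?thesis unfolding lookup_R3 by (simp cong: conj_cong)
qed

text \<open>Words whose letters have disjoint supports come only from commutators; in all the other
  terms of \<open>R2\<close> and \<open>R3\<close> the two letters share a vertex.\<close>

lemma lookup_swap:
  assumes "r \<in> rels (Q_alg n E)" "supp x \<inter> supp y = {}"
  shows "Poly_Mapping.lookup r (Wd [x, y]) + Poly_Mapping.lookup r (Wd [y, x]) = 0"
proof -
  have mixed: "Poly_Mapping.lookup r (Wd [Vertex a, Edge e]) + Poly_Mapping.lookup r (Wd [Edge e, Vertex a]) = 0"
    if a: "a \<notin> e" for a e
    using assms(1)
  proof (cases r rule: relsE)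
    case (R2 i j)
    then have "e = {i, j} \<Longrightarrow> a \<noteq> i" "e = {i, j} \<Longrightarrow> a \<noteq> j" using a by auto
    then show ?thesis by (simp add: R2 lookup_R2 cong: conj_cong)
  qed (simp_all add: lookup_R3 lookup_R4 of_bool_conj algebra_simps)
  show ?thesis
  proof (cases x; cases y)
    fix a b assume "x = Vertex a" "y = Vertex b"
    with assms(1) show ?thesis
      by (cases r rule: relsE) (simp_all add: lookup_R2 lookup_R3 lookup_R4 of_bool_conj algebra_simps)
  next
    fix e f assume "x = Edge e" "y = Edge f"
    with assms show ?thesis
      by (cases r rule: relsE) (simp_all add: lookup_R2 lookup_R3_disjoint lookup_R4 of_bool_conj algebra_simps Int_commute)
  next
    fix a e assume "x = Vertex a" "y = Edge e"
    then show ?thesis using mixed[of a e] assms(2) by simp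
  next
    fix a e assume "x = Edge e" "y = Vertex a"
    then show ?thesis using mixed[of a e] assms(2) by (simp add: add.commute)
  qed
qed

lemma swap_in_ideal:
  assumes "x \<in> G" "y \<in> G" "supp x \<inter> supp y = {}"
  shows "generator x * generator y + generator y * generator x
    \<in> relation_ideal (Q_dual :: (gen, 'k::field) quadratic)"
proof (rule orthogonal_in_ideal)
  fix r :: "(gen, 'k) falg" assume "r \<in> rels (Q_alg n E)"
  then show "pairing r (generator x * generator y + generator y * generator x) = 0"
    unfolding lf_add[OF linear_functional_pairing] pairing_generators using assms(3)
    by (rule lookup_swap)
qed (intro subspace_add[OF subspace_tensor_power] generators_tensor_power assms)

text \<open>No defining relation contains a vertex followed by a letter through that vertex: the
  correction terms put the edge first.\<close>

lemma vertex_in_ideal: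
  assumes "Vertex v \<in> G" "x \<in> G" "v \<in> supp x"
  shows "generator (Vertex v) * generator x \<in> relation_ideal (Q_dual :: (gen, 'k::field) quadratic)"
proof (rule orthogonal_in_ideal)
  fix r :: "(gen, 'k) falg" assume r: "r \<in> rels (Q_alg n E)"
  show "pairing r (generator (Vertex v) * generator x) = 0"
    unfolding pairing_generators
  proof (cases x)
    case (Vertex w)
    from r show "Poly_Mapping.lookup r (Wd [Vertex v, x]) = 0"
      by (cases r rule: relsE) (use Vertex assms(3) in \<open>auto simp: lookup_R2 lookup_R3 lookup_R4\<close>)
  next
    case (Edge e)
    from r show "Poly_Mapping.lookup r (Wd [Vertex v, x]) = 0"
    proof (cases r rule: relsE)
      case (R3 i j k)
      then have "v = i \<Longrightarrow> e \<noteq> {j, k}" "v = j \<Longrightarrow> e \<noteq> {i, k}" using assms(3) Edge by auto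
      then show ?thesis by (simp add: R3 Edge lookup_R3 cong: conj_cong)
    qed (simp_all add: Edge lookup_R2 lookup_R4)
  qed
qed (intro generators_tensor_power assms)

text \<open>The correction terms balance the commutators: before a letter through \<open>u\<close>,
  the letters \<open>Edge {u, v}\<close> and \<open>Vertex v\<close> have equal coefficients. In
  \<open>R2 E u v\<close>, for instance, both have coefficient -1 before
  \<open>Vertex u\<close>.\<close>

lemma edge_in_ideal:
  assumes "{u, v} \<in> E" "x \<in> G" "u \<in> supp x" "u \<noteq> v"
  shows "generator (Edge {u, v}) * generator x - generator (Vertex v) * generator x
    \<in> relation_ideal (Q_dual :: (gen, 'k::field) quadratic)"
proof (rule orthogonal_in_ideal)
  fix r :: "(gen, 'k) falg" assume r: "r \<in> rels (Q_alg n E)"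
  show "pairing r (generator (Edge {u, v}) * generator x - generator (Vertex v) * generator x) = 0"
    unfolding lf_diff[OF linear_functional_pairing] pairing_generators
  proof (cases x)
    case (Vertex w)
    then have x: "x = Vertex u" using assms(3) by simp
    from r show "Poly_Mapping.lookup r (Wd [Edge {u, v}, x]) - Poly_Mapping.lookup r (Wd [Vertex v, x]) = 0"
    proof (cases r rule: relsE)
      case (R2 i j)
      have "({u, v} = {i, j} \<and> {i, j} \<in> E \<and> u = i) = (v = j \<and> u = i)"
        "({u, v} = {i, j} \<and> {i, j} \<in> E \<and> u = j) = (v = i \<and> u = j)"
        using assms(1,4) by (auto simp: doubleton_eq_iff insert_commute)
      then show ?thesis by (simp add: R2 x lookup_R2)
    next
      case (R3 i j k)
      then have "{u, v} = {i, k} \<Longrightarrow> u \<noteq> j" "{u, v} = {j, k} \<Longrightarrow> u \<noteq> i" by (auto simp: doubleton_eq_iff)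
      then show ?thesis by (simp add: R3 x lookup_R3 cong: conj_cong)
    qed (simp add: x lookup_R4)
  next
    case (Edge e)
    then obtain w where w: "x = Edge {u, w}" "u \<noteq> w" "{u, w} \<in> E"
      using assms edge_otherE[of e u] by auto
    from r show "Poly_Mapping.lookup r (Wd [Edge {u, v}, x]) - Poly_Mapping.lookup r (Wd [Vertex v, x]) = 0"
    proof (cases r rule: relsE)
      case (R3 i j k)
      \<comment> \<open>\<open>P\<close> records which of the indices of \<open>R3\<close> are
        \<open>u\<close>, \<open>v\<close> and \<open>w\<close>. An edge-edge word fixes this,
        \<open>u\<close> being the common vertex; a vertex-edge word leaves two placements.\<close>
      define P where "P a b c \<longleftrightarrow> u = a \<and> v = b \<and> w = c" for a b c
      have E: "{u, v} \<in> E" "{v, u} \<in> E" "{u, w} \<in> E" "{w, u} \<in> E"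
        using assms(1) w(3) by (simp_all add: insert_commute)
      have two: "({u, v} = {a, c} \<and> {a, c} \<in> E \<and> {u, w} = {b, c} \<and> {b, c} \<in> E) = P c a b"
        if "a \<noteq> b" "b \<noteq> c" "a \<noteq> c" for a b c
        using that E assms(4) w(2) by (auto simp: P_def doubleton_eq_iff)
      have one: "of_bool (v = a \<and> {u, w} = {b, c} \<and> {b, c} \<in> E) = (of_bool (P c a b) + of_bool (P b a c) :: 'k)"
        if "a \<noteq> b" "b \<noteq> c" "a \<noteq> c" for a b c
        using that E by (auto simp: P_def doubleton_eq_iff)
      show ?thesis
        using two[of i j k] two[of j i k] two[of j k i] two[of i k j] one[of i j k] one[of j i k] R3(1-3)
        by (simp add: R3(4) w(1) lookup_R3 insert_commute)
    next
      case (R4 i j k l)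
      then have "{u, v} = {i, j} \<Longrightarrow> {u, w} \<noteq> {k, l}" "{u, v} = {k, l} \<Longrightarrow> {u, w} \<noteq> {i, j}"
        by (auto simp: doubleton_eq_iff)
      then show ?thesis by (simp add: R4 w(1) lookup_R4 cong: conj_cong)
    qed (simp add: w(1) lookup_R2)
  qed
next
  have "Vertex v \<in> G" using supp_G(1)[of "Edge {u, v}"] assms by auto
  then show "generator (Edge {u, v}) * generator x - generator (Vertex v) * generator x \<in> tensor_power G 2"
    by (intro subspace_diff[OF subspace_tensor_power] generators_tensor_power) (use assms in auto)
qed

lemma sum_of_bool_triangle:
  assumes T: "triangle E T" and "i \<noteq> j" "i \<noteq> k"
  shows "(\<Sum>v\<in>T. of_bool (v = i \<and> T - {v} = {j, k} \<and> {j, k} \<in> E)) = (of_bool (T = {i, j, k}) :: 'a::semiring_1)"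
proof (cases "T = {i, j, k}")
  case True
  then have jk: "T - {i} = {j, k}" using assms(2,3) by blast
  moreover have "{j, k} \<in> E" using triangle_edge[OF T, of i] True unfolding jk by simp
  ultimately have "(\<Sum>v\<in>T. of_bool (v = i \<and> T - {v} = {j, k} \<and> {j, k} \<in> E))
    = (\<Sum>v\<in>T. if v = i then 1 else 0 :: 'a)"
    by (intro sum.cong) auto
  also have "\<dots> = 1" using True by simp
  finally show ?thesis using True by simp
next
  case False
  then have "\<not> (v = i \<and> T - {v} = {j, k})" if "v \<in> T" for v
    using that by auto
  then show ?thesis using False by (auto intro!: sum.neutral)
qed

text \<open>In \<open>R3 E i j k\<close> the vertex-first words are \<open>i\<close> before
  \<open>{j, k}\<close>, with coefficient 1, and \<open>j\<close> before \<open>{i, k}\<close>, with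
  coefficient -1. Either both occur in the sum over \<open>T\<close> or neither does.\<close>

lemma triangle_in_ideal:
  assumes T: "triangle E T"
  shows "(\<Sum>v\<in>T. generator (Vertex v) * generator (Edge (T - {v})))
    \<in> relation_ideal (Q_dual :: (gen, 'k::field) quadratic)"
proof (rule orthogonal_in_ideal)
  fix r :: "(gen, 'k) falg" assume r: "r \<in> rels (Q_alg n E)"
  have "pairing r (\<Sum>v\<in>T. generator (Vertex v) * generator (Edge (T - {v})))
    = (\<Sum>v\<in>T. Poly_Mapping.lookup r (Wd [Vertex v, Edge (T - {v})]))"
    unfolding lf_sum[OF linear_functional_pairing] pairing_generators ..
  also have "\<dots> = 0"
    using r
  proof (cases r rule: relsE)
    case (R3 i j k)
    then show ?thesis
      using sum_of_bool_triangle[OF T, of i j k, where 'a = 'k] sum_of_bool_triangle[OF T, of j i k, where 'a = 'k]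
      by (simp add: lookup_R3 sum_subtractf insert_commute)
  qed (simp_all add: lookup_R2 lookup_R4)
  finally show "pairing r (\<Sum>v\<in>T. generator (Vertex v) * generator (Edge (T - {v}))) = 0" .
next
  show "(\<Sum>v\<in>T. generator (Vertex v) * generator (Edge (T - {v}))) \<in> tensor_power G 2"
    using triangle_edge[OF T] triangle_le[OF T]
    by (intro subspace_sum[OF subspace_tensor_power] generators_tensor_power) auto
qed

section \<open>Rewriting words modulo the dual ideal\<close>

definition left_quotient :: "gen \<Rightarrow> (gen, 'k::field) falg set \<Rightarrow> (gen, 'k) falg set"
  where "left_quotient x V = {f. generator x * f \<in> V}"

text \<open>Linear combinations modulo the ideal are handled through membership in such subspaces:
  rewriting by an element of the ideal does not change membership, and no coefficients are
  needed.\<close>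

definition absorbing :: "(gen, 'k::field) falg set \<Rightarrow> bool"
  where "absorbing V \<longleftrightarrow> falg_subspace V \<and> relation_ideal Q_dual \<subseteq> V"

lemma absorbingD: "absorbing V \<Longrightarrow> falg_subspace V" "absorbing V \<Longrightarrow> f \<in> relation_ideal Q_dual \<Longrightarrow> f \<in> V"
  by (auto simp: absorbing_def)

lemma monomial_carrier: "set w \<subseteq> G \<Longrightarrow> monomial w \<in> carrier (free_algebra G)"
  using monomial_tensor_power[of w G "length w"] tensor_power_carrier by blast

lemma ideal_mult:
  assumes "f \<in> relation_ideal Q_dual" "set w \<subseteq> G"
  shows "monomial w * f \<in> relation_ideal Q_dual" "f * monomial w \<in> relation_ideal Q_dual"
  using ideal.I_l_closed[OF ideal_Q_dual assms(1) monomial_carrier[OF assms(2)]]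
    ideal.I_r_closed[OF ideal_Q_dual assms(1) monomial_carrier[OF assms(2)]] by simp_all

text \<open>This drives the inductions on words: removing the first letter replaces \<open>V\<close>
  by its left quotient.\<close>

lemma absorbing_left_quotient:
  assumes V: "absorbing V" and x: "x \<in> G"
  shows "absorbing (left_quotient x V)"
  unfolding absorbing_def
proof
  have "generator x * (scalar a * f) = scalar a * (generator x * f)" for a and f :: "(gen, 'a) falg"
    by (metis scalar_commute mult.assoc)
  then show "falg_subspace (left_quotient x V)"
    using subspaceD[OF absorbingD(1)[OF V]]
    by (simp add: falg_subspace_def left_quotient_def distrib_left)
  have "generator x = (monomial [x] :: (gen, 'a) falg)" by (simp add: monomial_Cons monomial_Nil)
  then show "relation_ideal Q_dual \<subseteq> left_quotient x V"
    using ideal_mult(1)[of _ "[x]"] x absorbingD(2)[OF V] by (auto simp: left_quotient_def)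
qed

lemma monomial_left_quotient: "monomial xs \<in> left_quotient x V \<longleftrightarrow> monomial (x # xs) \<in> V"
  by (simp add: left_quotient_def monomial_Cons)

text \<open>Membership in a subspace ignores signs, so reordering needs no account of them.\<close>

lemma monomial_swap:
  assumes V: "absorbing V" and xy: "x \<in> G" "y \<in> G" "supp x \<inter> supp y = {}" and xs: "set xs \<subseteq> G"
  shows "monomial (x # y # xs) \<in> V \<longleftrightarrow> monomial (y # x # xs) \<in> V"
proof -
  have "(generator x * generator y + generator y * generator x) * monomial xs \<in> V"
    by (intro absorbingD(2)[OF V] ideal_mult(2) swap_in_ideal xy xs)
  then have s: "monomial (x # y # xs) + monomial (y # x # xs) \<in> V"
    by (simp add: monomial_Cons algebra_simps)
  note diff = subspace_diff[OF absorbingD(1)[OF V] s]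
  show ?thesis using diff[of "monomial (x # y # xs)"] diff[of "monomial (y # x # xs)"] by auto
qed

lemma monomial_move:
  assumes "absorbing V" "x \<in> G" "set as \<subseteq> G" "set bs \<subseteq> G" "\<And>y. y \<in> set as \<Longrightarrow> supp x \<inter> supp y = {}"
  shows "monomial (as @ x # bs) \<in> V \<longleftrightarrow> monomial (x # as @ bs) \<in> V"
  using assms
proof (induction as arbitrary: V)
  case (Cons a as)
  have "monomial ((a # as) @ x # bs) \<in> V \<longleftrightarrow> monomial (as @ x # bs) \<in> left_quotient a V"
    by (simp add: monomial_left_quotient)
  also have "\<dots> \<longleftrightarrow> monomial (x # as @ bs) \<in> left_quotient a V"
    using Cons.prems by (intro Cons.IH absorbing_left_quotient) auto
  also have "\<dots> \<longleftrightarrow> monomial (a # x # as @ bs) \<in> V"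
    by (simp add: monomial_left_quotient)
  also have "\<dots> \<longleftrightarrow> monomial (x # a # as @ bs) \<in> V"
    using Cons.prems by (intro monomial_swap) auto
  finally show ?case by simp
qed simp

lemma states_subset: "X \<in> states \<Longrightarrow> Y \<subseteq> X \<Longrightarrow> Y \<in> states"
  unfolding states_def by blast

lemma states_insert:
  assumes x: "x \<notin> X"
  shows "insert x X \<in> states \<longleftrightarrow> x \<in> G \<and> X \<in> states \<and> supp x \<inter> touched X = {}"
proof -
  have t: "supp x \<inter> touched X = {} \<longleftrightarrow> (\<forall>g\<in>X. supp x \<inter> supp g = {})"
    by (auto simp: touched_def)
  show ?thesis
  proof
    assume s: "insert x X \<in> states"
    have "supp x \<inter> supp g = {}" if "g \<in> X" for g
    proof -
      have "x \<noteq> g" using that x by blast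
      then show ?thesis using s that unfolding states_def by simp
    qed
    then show "x \<in> G \<and> X \<in> states \<and> supp x \<inter> touched X = {}"
      using t statesD[OF s] states_subset[OF s subset_insertI] by blast
  next
    assume s: "x \<in> G \<and> X \<in> states \<and> supp x \<inter> touched X = {}"
    show "insert x X \<in> states"
      unfolding states_def
    proof (intro CollectI conjI ballI impI)
      show "insert x X \<subseteq> G" using s statesD by simp
      fix g h assume "g \<in> insert x X" "h \<in> insert x X" "g \<noteq> h"
      then consider "g = x" "h \<in> X" | "h = x" "g \<in> X" | "g \<in> X" "h \<in> X" by blast
      then show "supp g \<inter> supp h = {}"
      proof cases
        case 3
        with s \<open>g \<noteq> h\<close> show ?thesis unfolding states_def by simp
      qed (use s t in \<open>simp_all add: Int_commute\<close>)
    qed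
  qed
qed

lemma monomial_front:
  assumes V: "absorbing V" and xs: "distinct (as @ x # bs)" "set (as @ x # bs) \<in> states"
  shows "monomial (as @ x # bs) \<in> V \<longleftrightarrow> monomial (x # as @ bs) \<in> V"
  by (rule monomial_move[OF V]) (use xs in \<open>auto simp: states_def\<close>)

lemma monomial_perm:
  assumes "absorbing V" "distinct xs" "set xs \<in> states" "distinct ys" "set ys = set xs"
  shows "monomial xs \<in> V \<longleftrightarrow> monomial ys \<in> V"
  using assms
proof (induction xs arbitrary: ys V)
  case (Cons x xs)
  then obtain as bs where ys: "ys = as @ x # bs"
    by (metis list.set_intros(1) split_list)
  have set: "set (as @ bs) = set xs"
    using Cons.prems ys by auto
  have "monomial (x # xs) \<in> V \<longleftrightarrow> monomial xs \<in> left_quotient x V"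
    by (simp add: monomial_left_quotient)
  also have "\<dots> \<longleftrightarrow> monomial (as @ bs) \<in> left_quotient x V"
  proof (rule Cons.IH)
    show "absorbing (left_quotient x V)"
      using Cons.prems by (intro absorbing_left_quotient) (auto simp: states_def)
    show "set xs \<in> states" by (rule states_subset[OF Cons.prems(3)]) auto
  qed (use Cons.prems set ys in auto)
  also have "\<dots> \<longleftrightarrow> monomial (x # as @ bs) \<in> V"
    by (simp add: monomial_left_quotient)
  also have "\<dots> \<longleftrightarrow> monomial ys \<in> V"
    unfolding ys using Cons.prems by (intro monomial_front[symmetric]) (auto simp: ys)
  finally show ?case .
qed simp

text \<open>An occupied \<open>v\<close> lies in the support of some letter \<open>h\<close>; with
  \<open>h\<close> moved to the front, the first two letters already form an element of the
  ideal.\<close>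

lemma monomial_vertex:
  assumes V: "absorbing V" and xs: "distinct xs" "set xs \<in> states" and v: "v \<in> {1..n}"
    and indep: "\<And>ys. distinct ys \<Longrightarrow> set ys \<in> states \<Longrightarrow> length ys = Suc (length xs) \<Longrightarrow> monomial ys \<in> V"
  shows "monomial (Vertex v # xs) \<in> V"
proof (cases "v \<in> touched (set xs)")
  case False
  then have "Vertex v \<notin> set xs" by (auto simp: touched_def)
  then show ?thesis using False xs v by (intro indep) (simp_all add: states_insert)
next
  case True
  then obtain h where h: "h \<in> set xs" "v \<in> supp h" by (auto simp: touched_def)
  then obtain as bs where asbs: "xs = as @ h # bs" by (metis split_list)
  have G: "set xs \<subseteq> G" by (rule statesD[OF xs(2)])
  have "generator (Vertex v) * generator h * monomial (as @ bs) \<in> V"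
    using v h G asbs by (intro absorbingD(2)[OF V] ideal_mult(2) vertex_in_ideal) auto
  then have "monomial (h # as @ bs) \<in> left_quotient (Vertex v) V"
    by (simp add: left_quotient_def monomial_Cons mult.assoc)
  moreover have "absorbing (left_quotient (Vertex v) V)"
    using v by (intro absorbing_left_quotient V) simp
  ultimately have "monomial xs \<in> left_quotient (Vertex v) V"
    using monomial_front xs unfolding asbs by blast
  then show ?thesis by (simp add: monomial_left_quotient)
qed

text \<open>With a letter meeting \<open>e\<close> at \<open>u\<close> moved to the front,
  \<open>Edge e\<close> may be replaced by its other end, which leaves the case of a vertex.\<close>

lemma monomial_edge:
  assumes V: "absorbing V" and xs: "distinct xs" "set xs \<in> states" and e: "e \<in> E"
    and indep: "\<And>ys. distinct ys \<Longrightarrow> set ys \<in> states \<Longrightarrow> length ys = Suc (length xs) \<Longrightarrow> monomial ys \<in> V"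
  shows "monomial (Edge e # xs) \<in> V"
proof (cases "e \<inter> touched (set xs) = {}")
  case True
  then have "Edge e \<notin> set xs" using not_in_untouched[of "Edge e" "set xs"] e by simp
  then show ?thesis using True xs e by (intro indep) (simp_all add: states_insert)
next
  case False
  then obtain h u where h: "h \<in> set xs" "u \<in> supp h" "u \<in> e" by (auto simp: touched_def)
  then obtain as bs where asbs: "xs = as @ h # bs" by (metis split_list)
  obtain v where uv: "e = {u, v}" "u \<noteq> v" "v \<in> {1..n}"
    using edge_otherE[OF e h(3)] by blast
  have G: "set xs \<subseteq> G" by (rule statesD[OF xs(2)])
  have set: "set (h # as @ bs) = set xs" by (auto simp: asbs)
  have "monomial (Vertex v # h # as @ bs) \<in> V"
    using xs set asbs by (intro monomial_vertex[OF V] uv indep) auto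
  moreover have "(generator (Edge e) * generator h - generator (Vertex v) * generator h) * monomial (as @ bs) \<in> V"
    unfolding uv(1) using uv e h G asbs
    by (intro absorbingD(2)[OF V] ideal_mult(2) edge_in_ideal) auto
  then have "monomial (Edge e # h # as @ bs) - monomial (Vertex v # h # as @ bs) \<in> V"
    by (simp add: monomial_Cons mult.assoc left_diff_distrib)
  ultimately have "monomial (h # as @ bs) \<in> left_quotient (Edge e) V"
    using subspace_add[OF absorbingD(1)[OF V]] by (fastforce simp: monomial_left_quotient)
  moreover have "absorbing (left_quotient (Edge e) V)"
    using e by (intro absorbing_left_quotient V) simp
  ultimately have "monomial xs \<in> left_quotient (Edge e) V"
    using monomial_front xs unfolding asbs by blast
  then show ?thesis by (simp add: monomial_left_quotient)
qed

lemma monomial_word: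
  assumes "absorbing V" "set w \<subseteq> G"
    "\<And>ys. distinct ys \<Longrightarrow> set ys \<in> states \<Longrightarrow> length ys = length w \<Longrightarrow> monomial ys \<in> V"
  shows "monomial w \<in> V"
  using assms
proof (induction w arbitrary: V)
  case Nil
  then show ?case by (simp add: states_def)
next
  case (Cons x w)
  have "monomial w \<in> left_quotient x V"
  proof (rule Cons.IH)
    fix ys assume ys: "distinct ys" "set ys \<in> states" "length ys = length w"
    have "monomial (x # ys) \<in> V"
    proof (cases x)
      case (Vertex v)
      then show ?thesis
        using Cons.prems ys unfolding Vertex by (intro monomial_vertex) auto
    next
      case (Edge e)
      then show ?thesis
        using Cons.prems ys unfolding Edge by (intro monomial_edge) auto
    qed
    then show "monomial ys \<in> left_quotient x V" by (simp add: monomial_left_quotient)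
  qed (use Cons.prems in \<open>auto intro: absorbing_left_quotient\<close>)
  then show ?case by (simp add: monomial_left_quotient)
qed

section \<open>Eliminating the dropped products\<close>

lemma finite_bad: "finite {T. triangle E T \<and> bad T \<subseteq> X}"
  using finite_triangles by (rule finite_subset[rotated]) auto

text \<open>Replacing \<open>bad T\<close> by another pair of \<open>T\<close> creates no bad pair:
  other triangles share no generators with \<open>T\<close>, and \<open>Max T\<close> is now an end
  of the edge \<open>T - {v}\<close>.\<close>

lemma bad_vertex_edge:
  assumes "triangle E T" "triangle E S" "v \<in> T" "bad S \<subseteq> vertex_edge T v \<union> X" "v \<noteq> Max T"
    "vertex_edge T v \<union> X \<in> states"
  shows "S \<noteq> T \<and> bad S \<subseteq> X"
proof -
  have "S \<noteq> T"
  proof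
    assume "S = T"
    have "Vertex (Max T) \<in> bad S" unfolding \<open>S = T\<close> by (simp add: bad_def vertex_edge_def)
    then have "Vertex (Max T) \<in> vertex_edge T v \<union> X" using assms(4) by blast
    moreover have "Edge (T - {v}) \<in> vertex_edge T v \<union> X"
      by (simp add: vertex_edge_def)
    moreover have "\<forall>g\<in>vertex_edge T v \<union> X. \<forall>h\<in>vertex_edge T v \<union> X. g \<noteq> h \<longrightarrow> supp g \<inter> supp h = {}"
      using assms(6) unfolding states_def by blast
    ultimately have "supp (Vertex (Max T)) \<inter> supp (Edge (T - {v})) = {}"
      by blast
    then show False using Max_triangle[OF assms(1)] assms(5) by simp
  qed
  moreover have "bad S \<inter> vertex_edge T v = {}"
    using inside_disjoint[OF assms(2,1) \<open>S \<noteq> T\<close>] bad_inside[OF assms(2)] vertex_edge_inside[OF assms(1,3)]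
    by blast
  ultimately show ?thesis using assms(4) by blast
qed

text \<open>The triangle relation times the rest of the word expresses a word containing
  \<open>bad T\<close> by two others. The number of triangles whose bad pair occurs drops each
  time.\<close>

lemma monomial_good:
  assumes V: "absorbing V" and xs: "distinct xs" "set xs \<in> states"
    and good: "\<And>ys. distinct ys \<Longrightarrow> set ys \<in> good \<Longrightarrow> length ys = length xs \<Longrightarrow> monomial ys \<in> V"
  shows "monomial xs \<in> V"
  using xs good
proof (induction "card {T. triangle E T \<and> bad T \<subseteq> set xs}" arbitrary: xs rule: less_induct)
  case less
  show ?case
  proof (cases "set xs \<in> good")
    case True
    then show ?thesis using less.prems by blast
  next
    case False
    then obtain T where T: "triangle E T" "bad T \<subseteq> set xs"
      using less.prems by (auto simp: good_def)
    let ?m = "Max T"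
    have m: "?m \<in> T" by (rule Max_triangle[OF T(1)])
    define X where "X = set xs - bad T"
    have X: "set xs = vertex_edge T ?m \<union> X" using T(2) by (auto simp: X_def bad_def)
    have XG: "X \<subseteq> G" using statesD[OF less.prems(2)] by (auto simp: X_def)
    obtain rs where rs: "set rs = X" "distinct rs"
      using finite_distinct_list[of X] by (auto simp: X_def)
    let ?ys = "\<lambda>v. Vertex v # Edge (T - {v}) # rs"
    have TX: "T \<inter> touched X = {}"
    proof -
      have "supp g \<inter> supp h = {}" if "g \<in> bad T" "h \<in> X" for g h
      proof -
        have "g \<in> set xs" "h \<in> set xs" "g \<noteq> h" using that T(2) by (auto simp: X_def)
        then show ?thesis using less.prems(2) unfolding states_def by simp
      qed
      then have "touched (bad T) \<inter> touched X = {}" by (fastforce simp: touched_def)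
      then show ?thesis using touched_vertex_edge[OF m] by (simp add: bad_def)
    qed
    have set_ys: "set (?ys v) = vertex_edge T v \<union> X" for v
      by (simp add: vertex_edge_def rs)
    have ys: "distinct (?ys v)" "set (?ys v) \<in> states" if v: "v \<in> T" for v
    proof -
      have G: "Vertex v \<in> G" "Edge (T - {v}) \<in> G"
        using vertex_edge_G[OF T(1) v] by (auto simp: vertex_edge_def)
      have nin: "Vertex v \<notin> X" "Edge (T - {v}) \<notin> X"
        using v TX not_in_untouched[OF G(1), of X] not_in_untouched[OF G(2), of X] by auto
      then show "distinct (?ys v)" using rs by simp
      have "X \<in> states" using states_subset[OF less.prems(2)] by (simp add: X_def)
      then have "insert (Edge (T - {v})) X \<in> states"
        using nin(2) G(2) TX by (auto simp: states_insert)
      then show "set (?ys v) \<in> states"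
        using nin(1) G(1) TX v by (auto simp: states_insert rs)
    qed
    have len: "length (?ys v) = length xs" if "v \<in> T" for v
    proof -
      have "card (set (?ys v)) = card (set (?ys ?m))"
        using distinct_card[OF ys(1)[OF that]] distinct_card[OF ys(1)[OF m]] by simp
      also have "set (?ys ?m) = set xs" by (simp only: set_ys X)
      finally show ?thesis
        using distinct_card[OF ys(1)[OF that]] distinct_card[OF less.prems(1)] by simp
    qed
    have other: "monomial (?ys v) \<in> V" if v: "v \<in> T - {?m}" for v
    proof (rule less.hyps)
      have "{S. triangle E S \<and> bad S \<subseteq> set (?ys v)} \<subset> {S. triangle E S \<and> bad S \<subseteq> set xs}"
      proof (rule psubsetI)
        show "{S. triangle E S \<and> bad S \<subseteq> set (?ys v)} \<subseteq> {S. triangle E S \<and> bad S \<subseteq> set xs}"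
          using bad_vertex_edge[OF T(1)] v ys(2)[of v] unfolding set_ys X by blast
        have "T \<notin> {S. triangle E S \<and> bad S \<subseteq> set (?ys v)}"
          using bad_vertex_edge[OF T(1) T(1)] v ys(2)[of v] unfolding set_ys by blast
        then show "{S. triangle E S \<and> bad S \<subseteq> set (?ys v)} \<noteq> {S. triangle E S \<and> bad S \<subseteq> set xs}"
          using T by blast
      qed
      then show "card {S. triangle E S \<and> bad S \<subseteq> set (?ys v)} < card {S. triangle E S \<and> bad S \<subseteq> set xs}"
        by (rule psubset_card_mono[OF finite_bad])
      show "distinct (?ys v)" "set (?ys v) \<in> states" using ys v by blast+
      show "monomial zs \<in> V" if "distinct zs" "set zs \<in> good" "length zs = length (?ys v)" for zs
        using that len[of v] v by (intro less.prems(3)) auto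
    qed
    have "(\<Sum>v\<in>T. generator (Vertex v) * generator (Edge (T - {v}))) * monomial rs \<in> V"
      using rs XG by (intro absorbingD(2)[OF V] ideal_mult(2) triangle_in_ideal T) auto
    then have "(\<Sum>v\<in>T. monomial (?ys v)) \<in> V"
      by (simp add: sum_distrib_right monomial_Cons mult.assoc)
    then have "monomial (?ys ?m) + (\<Sum>v\<in>T - {?m}. monomial (?ys v)) \<in> V"
      by (simp add: sum.remove[OF triangle_finite[OF T(1)] m])
    moreover have "(\<Sum>v\<in>T - {?m}. monomial (?ys v)) \<in> V"
      by (rule subspace_sum[OF absorbingD(1)[OF V] other])
    ultimately have "monomial (?ys ?m) \<in> V"
      using subspace_diff[OF absorbingD(1)[OF V]] by fastforce
    then show ?thesis
      using monomial_perm[OF V ys[OF m] less.prems(1)] X set_ys[of ?m] by blast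
  qed
qed

lemma monomial_span:
  assumes V: "absorbing V" and w: "set w \<subseteq> G"
    and good: "\<And>ys. distinct ys \<Longrightarrow> set ys \<in> good \<Longrightarrow> length ys = length w \<Longrightarrow> monomial ys \<in> V"
  shows "monomial w \<in> V"
  by (rule monomial_word[OF V w]) (rule monomial_good[OF V]; simp add: good)

end

section \<open>Counting states\<close>

text \<open>The case distinction is needed because truncated subtraction would give
  \<open>N choose 0\<close> for \<open>t < m\<close>.\<close>

definition level :: "nat \<Rightarrow> nat \<Rightarrow> nat \<Rightarrow> nat"
  where "level N m t = (if m \<le> t then N choose (t - m) else 0)"

text \<open>A row of binomials is symmetric and increases up to its middle. If \<open>b\<close> is
  past the middle, it is reflected to \<open>N - b\<close>, which is still at least
  \<open>a\<close>.\<close>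

lemma choose_mono_symmetric:
  assumes "a \<le> b" "a + b \<le> N" shows "N choose a \<le> N choose b"
proof (cases "2 * b \<le> N")
  case True
  then show ?thesis using assms(1) by (intro binomial_mono) auto
next
  case False
  then have "N choose a \<le> N choose (N - b)" using assms by (intro binomial_mono) auto
  also have "\<dots> = N choose b" using assms by (intro binomial_symmetric[symmetric]) auto
  finally show ?thesis .
qed

text \<open>Reflection in row \<open>N\<close> moves \<open>n - t - m\<close> to
  \<open>N - (n - t - m)\<close>, which is at most \<open>t - m\<close>; the sum of these two
  positions is at most \<open>N\<close> because \<open>2 * t \<le> n\<close>.\<close>

lemma level_reflect:
  assumes N: "N + 2 * m \<le> n" and t: "2 * t \<le> n"
  shows "level N m (n - t) \<le> level N m t"
proof (cases "N < n - t - m")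
  case True
  then show ?thesis by (simp add: level_def binomial_eq_0)
next
  case False
  with N have m: "m \<le> t" "m \<le> n - t" using t by auto
  have "N choose (n - t - m) = N choose (N - (n - t - m))"
    using False by (intro binomial_symmetric) auto
  also have "\<dots> \<le> N choose (t - m)"
    using N t False m by (intro choose_mono_symmetric) auto
  finally show ?thesis using m by (simp add: level_def)
qed

text \<open>For \<open>m \<le> t\<close> this is the symmetry of row \<open>N\<close>; otherwise
  \<open>n - t - m\<close> exceeds \<open>N\<close> and both sides are 0.\<close>

lemma level_symmetric:
  assumes N: "N + 2 * m = n" and t: "2 * t \<le> n"
  shows "level N m (n - t) = level N m t"
proof (cases "m \<le> t")
  case True
  then have "N choose (t - m) = N choose (N - (t - m))"
    using N t by (intro binomial_symmetric) auto
  also have "N - (t - m) = n - t - m" using N True t by auto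
  finally show ?thesis using True t by (simp add: level_def)
next
  case False
  then show ?thesis using N t by (auto simp: level_def)
qed

lemma level_0:
  assumes "N + 2 * m \<le> n" "n < t" shows "level N m t = 0"
  using assms by (simp add: level_def)

context graph_no_overlap
begin

lemma finite_good: "finite good"
proof (rule finite_subset)
  show "good \<subseteq> Pow G" using goodD statesD by blast
qed (simp add: finite_G)

section \<open>The Hilbert function of the dual algebra\<close>

lemma hilbert_function_Q_dual:
  "hilbert_function (Q_dual :: (gen, 'k::field) quadratic) t = card {X \<in> good. card X = t}"
proof -
  obtain \<sigma> :: "gen \<Rightarrow> gen \<Rightarrow> 'k" where "signed_graph n E \<sigma>" by (rule ex_signs)
  then interpret S: signed_graph n E \<sigma> .
  \<comment> \<open>A state has no preferred order of its letters; any enumeration serves, since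
    reordering does not affect membership in absorbing subspaces.\<close>
  define lst where "lst X = (SOME xs. distinct xs \<and> set xs = X)" for X :: "gen set"
  have lst: "distinct (lst X)" "set (lst X) = X" if "X \<in> good" for X
  proof -
    have "finite X" using that goodD statesD finite_G finite_subset by metis
    then have "\<exists>xs. distinct xs \<and> set xs = X" using finite_distinct_list by blast
    then have "distinct (lst X) \<and> set (lst X) = X" unfolding lst_def by (rule someI_ex)
    then show "distinct (lst X)" "set (lst X) = X" by auto
  qed
  let ?A = "Q_dual :: (gen, 'k) quadratic" and ?g = "{X \<in> good. card X = t}"
  have inj: "inj_on lst ?g"
    by (rule inj_on_inverseI[of _ set]) (use lst in auto)
  have "hilbert_function ?A t = card (lst ` ?g)"
  proof (rule hilbert_function_eq_card)
    show "rels ?A \<subseteq> carrier (free_algebra (gens ?A))"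
      unfolding gens_Q_dual by (rule rels_Q_dual)
    show "finite (lst ` ?g)" using finite_good by simp
    show "set b \<subseteq> gens ?A \<and> length b = t" if "b \<in> lst ` ?g" for b
      using that lst goodD statesD distinct_card by fastforce
    \<comment> \<open>The functional dual to the empty state is nonzero at \<open>1\<close>, so the
      quotient is not the zero ring.\<close>
    have "{} \<in> good" by (auto simp: good_def states_def bad_def vertex_edge_def)
    then obtain \<phi> :: "(gen, 'k) falg \<Rightarrow> 'k" where "\<forall>f\<in>relation_ideal ?A. \<phi> f = 0"
      "\<phi> (monomial []) \<noteq> 0"
      using S.ex_dual_functional[of "{}"] by force
    then show "1 \<notin> relation_ideal ?A" by (auto simp: monomial_Nil)
  next
    fix V :: "(gen, 'k) falg set" and w
    assume V: "falg_subspace V" "relation_ideal ?A \<subseteq> V" "\<forall>b\<in>lst ` ?g. monomial b \<in> V"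
      and w: "set w \<subseteq> gens ?A" "length w = t"
    have abs: "absorbing V" using V by (simp add: absorbing_def)
    show "monomial w \<in> V"
    proof (rule monomial_span[OF abs])
      fix ys assume ys: "distinct ys" "set ys \<in> good" "length ys = length w"
      then have "monomial (lst (set ys)) \<in> V"
        using V(3) w(2) distinct_card[of ys] by auto
      then show "monomial ys \<in> V"
        using monomial_perm[OF abs lst(1)[OF ys(2)] _ ys(1)] lst(2)[OF ys(2)] goodD[OF ys(2)] by simp
    qed (use w in simp)
  next
    fix b assume "b \<in> lst ` ?g"
    then obtain Y where Y: "Y \<in> good" "b = lst Y" by auto
    obtain \<phi> :: "(gen, 'k) falg \<Rightarrow> 'k" where \<phi>: "linear_functional \<phi>"
      "\<forall>f\<in>relation_ideal ?A. \<phi> f = 0"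
      "\<And>xs. distinct xs \<Longrightarrow> set xs \<in> good \<Longrightarrow> \<phi> (monomial xs) = 0 \<longleftrightarrow> set xs \<noteq> Y"
      using S.ex_dual_functional[OF Y(1)] by blast
    show "\<exists>\<phi>. linear_functional \<phi> \<and> (\<forall>f\<in>relation_ideal ?A. \<phi> f = 0)
      \<and> \<phi> (monomial b) \<noteq> 0 \<and> (\<forall>b'\<in>lst ` ?g. b' \<noteq> b \<longrightarrow> \<phi> (monomial b') = 0)"
    proof (intro exI[of _ \<phi>] conjI ballI impI \<phi>(1,2))
      show "\<phi> (monomial b) \<noteq> 0" using \<phi>(3)[of b] lst[OF Y(1)] Y by simp
      fix b' assume "b' \<in> lst ` ?g" "b' \<noteq> b"
      then show "\<phi> (monomial b') = 0" using \<phi>(3)[of b'] lst Y by auto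
    qed (use \<phi>(2) in blast)
  qed
  then show ?thesis using card_image[OF inj] by simp
qed

definition matchings :: "nat set set set"
  where "matchings = {M. M \<subseteq> E \<and> (\<forall>e\<in>M. \<forall>f\<in>M. e \<noteq> f \<longrightarrow> e \<inter> f = {})}"

text \<open>Once the edge \<open>T - {Max T}\<close> is in the matching, adding \<open>Max T\<close>
  would complete \<open>bad T\<close>.\<close>

definition free_vertices :: "nat set set \<Rightarrow> nat set"
  where "free_vertices M = {1..n} - \<Union>M - {Max T | T. triangle E T \<and> T - {Max T} \<in> M}"

lemma finite_matchings: "finite matchings"
proof (rule finite_subset)
  show "matchings \<subseteq> Pow E" by (auto simp: matchings_def)
qed (simp add: finite_E)

lemma finite_free_vertices: "finite (free_vertices M)"
  by (simp add: free_vertices_def)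

lemma states_split:
  "Vertex ` S \<union> Edge ` M \<in> states \<longleftrightarrow> M \<in> matchings \<and> S \<subseteq> {1..n} - \<Union>M"
proof
  assume X: "Vertex ` S \<union> Edge ` M \<in> states"
  have G: "S \<subseteq> {1..n}" "M \<subseteq> E" using statesD[OF X] by auto
  have disj: "supp g \<inter> supp h = {}" if "g \<in> Vertex ` S \<union> Edge ` M" "h \<in> Vertex ` S \<union> Edge ` M" "g \<noteq> h" for g h
    using X that unfolding states_def by simp
  have "e \<inter> f = {}" if "e \<in> M" "f \<in> M" "e \<noteq> f" for e f
    using disj[of "Edge e" "Edge f"] that by simp
  moreover have "v \<notin> e" if "v \<in> S" "e \<in> M" for v e
    using disj[of "Vertex v" "Edge e"] that by simp
  ultimately show "M \<in> matchings \<and> S \<subseteq> {1..n} - \<Union>M"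
    using G unfolding matchings_def by blast
next
  assume M: "M \<in> matchings \<and> S \<subseteq> {1..n} - \<Union>M"
  show "Vertex ` S \<union> Edge ` M \<in> states"
    unfolding states_def
  proof (intro CollectI conjI ballI impI)
    show "Vertex ` S \<union> Edge ` M \<subseteq> G" using M by (auto simp: G_def matchings_def)
    fix g h assume "g \<in> Vertex ` S \<union> Edge ` M" "h \<in> Vertex ` S \<union> Edge ` M" "g \<noteq> h"
    moreover have "e \<inter> f = {}" if "e \<in> M" "f \<in> M" "e \<noteq> f" for e f
      using M that unfolding matchings_def by simp
    ultimately show "supp g \<inter> supp h = {}"
      using M by (cases g; cases h) auto
  qed
qed

lemma good_split:
  "Vertex ` S \<union> Edge ` M \<in> good \<longleftrightarrow> M \<in> matchings \<and> S \<subseteq> free_vertices M"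
proof -
  have "bad T \<subseteq> Vertex ` S \<union> Edge ` M \<longleftrightarrow> Max T \<in> S \<and> T - {Max T} \<in> M" for T
    by (auto simp: bad_def vertex_edge_def)
  then show ?thesis
    unfolding good_def mem_Collect_eq states_split free_vertices_def by blast
qed

lemma card_good:
  "card {X \<in> good. card X = t} = (\<Sum>M\<in>matchings. level (card (free_vertices M)) (card M) t)"
proof -
  let ?P = "Sigma matchings (\<lambda>M. {S. S \<subseteq> free_vertices M \<and> card S + card M = t})"
  have card: "card (Vertex ` S \<union> Edge ` M) = card S + card M" if "finite S" "finite M" for S M
    using that by (subst card_Un_disjoint) (auto simp: card_image inj_on_def)
  have fin: "finite S" "finite M" if "M \<in> matchings" "S \<subseteq> free_vertices M" for S M
    using that finite_subset[OF _ finite_free_vertices] finite_subset[OF _ finite_E]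
    by (auto simp: matchings_def)
  have "bij_betw (\<lambda>(M, S). Vertex ` S \<union> Edge ` M) ?P {X \<in> good. card X = t}"
  proof (rule bij_betw_byWitness[where f' = "\<lambda>X. ({e. Edge e \<in> X}, {v. Vertex v \<in> X})"])
    have split: "Vertex ` {v. Vertex v \<in> X} \<union> Edge ` {e. Edge e \<in> X} = X" for X
    proof
      show "X \<subseteq> Vertex ` {v. Vertex v \<in> X} \<union> Edge ` {e. Edge e \<in> X}"
      proof
        fix g assume "g \<in> X"
        then show "g \<in> Vertex ` {v. Vertex v \<in> X} \<union> Edge ` {e. Edge e \<in> X}" by (cases g) auto
      qed
    qed auto
    show "\<forall>X\<in>{X \<in> good. card X = t}. (case ({e. Edge e \<in> X}, {v. Vertex v \<in> X}) of
        (M, S) \<Rightarrow> Vertex ` S \<union> Edge ` M) = X"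
      by (simp add: split)
    show "\<forall>p\<in>?P. ({e. Edge e \<in> (case p of (M, S) \<Rightarrow> Vertex ` S \<union> Edge ` M)},
        {v. Vertex v \<in> (case p of (M, S) \<Rightarrow> Vertex ` S \<union> Edge ` M)}) = p"
      by auto
    show "(\<lambda>(M, S). Vertex ` S \<union> Edge ` M) ` ?P \<subseteq> {X \<in> good. card X = t}"
    proof clarify
      fix M S assume "M \<in> matchings" "S \<subseteq> free_vertices M" "t = card S + card M"
      then show "Vertex ` S \<union> Edge ` M \<in> good \<and> card (Vertex ` S \<union> Edge ` M) = card S + card M"
        using good_split[of S M] card[OF fin] by simp
    qed
    show "(\<lambda>X. ({e. Edge e \<in> X}, {v. Vertex v \<in> X})) ` {X \<in> good. card X = t} \<subseteq> ?P"
    proof (rule image_subsetI)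
      fix X assume "X \<in> {X \<in> good. card X = t}"
      then have X: "X \<in> good" "card X = t" by auto
      let ?M = "{e. Edge e \<in> X}" and ?S = "{v. Vertex v \<in> X}"
      have MS: "?M \<in> matchings" "?S \<subseteq> free_vertices ?M"
        using X good_split[of ?S ?M] unfolding split by auto
      then show "(?M, ?S) \<in> ?P"
        using X(2) card[OF fin(1)[OF MS] fin(2)[OF MS]] unfolding split by simp
    qed
  qed
  then have "card {X \<in> good. card X = t} = card ?P" by (simp add: bij_betw_same_card)
  also have "\<dots> = (\<Sum>M\<in>matchings. card {S. S \<subseteq> free_vertices M \<and> card S + card M = t})"
  proof (rule card_SigmaI[OF finite_matchings ballI])
    show "finite {S. S \<subseteq> free_vertices M \<and> card S + card M = t}" for M
      by (rule finite_subset[of _ "Pow (free_vertices M)"]) (auto simp: finite_free_vertices)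
  qed
  also have "\<dots> = (\<Sum>M\<in>matchings. level (card (free_vertices M)) (card M) t)"
  proof (rule sum.cong)
    fix M
    show "card {S. S \<subseteq> free_vertices M \<and> card S + card M = t} = level (card (free_vertices M)) (card M) t"
    proof (cases "card M \<le> t")
      case True
      then have "{S. S \<subseteq> free_vertices M \<and> card S + card M = t} = {S. S \<subseteq> free_vertices M \<and> card S = t - card M}"
        by auto
      then show ?thesis using True by (simp add: level_def n_subsets finite_free_vertices)
    qed (auto simp: level_def)
  qed simp
  finally show ?thesis .
qed

lemma card_Union_matching:
  assumes "M \<in> matchings" shows "card (\<Union>M) = 2 * card M"
proof -
  have M: "M \<subseteq> E" using assms by (simp add: matchings_def)
  have card2: "card e = 2" if "e \<in> M" for e
    using M that by (auto elim!: edgeE)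
  have "card (\<Union>M) = sum card M"
  proof (rule card_Union_disjoint)
    show "pairwise disjnt M" using assms by (auto simp: matchings_def pairwise_def disjnt_def)
    show "finite e" if "e \<in> M" for e using card2[OF that] by (metis card.infinite zero_neq_numeral)
  qed
  also have "\<dots> = 2 * card M" using card2 by simp
  finally show ?thesis .
qed

lemma card_uncovered:
  assumes "M \<in> matchings" shows "card ({1..n} - \<Union>M) + 2 * card M = n"
proof -
  have "\<Union>M \<subseteq> {1..n}" using assms supp_G(1)[of "Edge _"] by (fastforce simp: matchings_def)
  then show ?thesis
    using card_Union_matching[OF assms] card_Diff_subset[of "\<Union>M" "{1..n}"]
      card_mono[of "{1..n}" "\<Union>M"] finite_subset[of "\<Union>M" "{1..n}"] by simp
qed

lemma card_free_vertices:
  assumes "M \<in> matchings" shows "card (free_vertices M) + 2 * card M \<le> n"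
proof -
  have "card (free_vertices M) \<le> card ({1..n} - \<Union>M)"
    by (intro card_mono) (auto simp: free_vertices_def)
  then show ?thesis using card_uncovered[OF assms] by linarith
qed

lemma card_free_vertices_triangle_free:
  assumes "triangle_free E" "M \<in> matchings" shows "card (free_vertices M) + 2 * card M = n"
proof -
  have "free_vertices M = {1..n} - \<Union>M"
    using assms(1) by (auto simp: free_vertices_def triangle_free_def)
  then show ?thesis using card_uncovered[OF assms(2)] by simp
qed

text \<open>The matching with the single edge opposite \<open>Max T\<close> loses
  \<open>Max T\<close> as a free vertex, so it has fewer than \<open>n - 2\<close> of them. It
  contributes 1 in degree 1 but 0 in degree \<open>n - 1\<close>; every other matching satisfies the
  weak inequality.\<close>

lemma triangle_strict:
  assumes T: "triangle E T"
  shows "card {X \<in> good. card X = n - 1} < card {X \<in> good. card X = 1}"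
  unfolding card_good
proof (rule sum_strict_mono_ex1[OF finite_matchings])
  have "card T \<le> card {1..n}" using triangle_le[OF T] by (intro card_mono) auto
  then have n: "3 \<le> n" using triangle_card[OF T] by simp
  show "\<forall>M\<in>matchings. level (card (free_vertices M)) (card M) (n - 1) \<le> level (card (free_vertices M)) (card M) 1"
    using card_free_vertices n by (intro ballI level_reflect) auto
  let ?M = "{T - {Max T}}"
  have M: "?M \<in> matchings"
    using triangle_edge[OF T Max_triangle[OF T]] by (auto simp: matchings_def)
  have "Max T \<in> {1..n} - \<Union>?M"
    using Max_triangle[OF T] triangle_le[OF T] by auto
  moreover have "Max T \<notin> free_vertices ?M" using T by (auto simp: free_vertices_def)
  moreover have "free_vertices ?M \<subseteq> {1..n} - \<Union>?M" by (auto simp: free_vertices_def)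
  ultimately have "free_vertices ?M \<subset> {1..n} - \<Union>?M" by blast
  then have "card (free_vertices ?M) < card ({1..n} - \<Union>?M)"
    by (intro psubset_card_mono) auto
  then have "card (free_vertices ?M) < n - 2" using card_uncovered[OF M] by simp
  then have "level (card (free_vertices ?M)) (card ?M) (n - 1) < level (card (free_vertices ?M)) (card ?M) 1"
    using n by (simp add: level_def numeral_2_eq_2)
  then show "\<exists>M\<in>matchings. level (card (free_vertices M)) (card M) (n - 1) < level (card (free_vertices M)) (card M) 1"
    using M by blast
qed

end

theorem corollary1p2:
  fixes n :: nat and E :: "nat set set" and p :: "nat \<Rightarrow> nat"
  assumes graph: "graph n E"
    and p: "p = hilbert_function (quadratic_dual (Q_alg n E :: (gen, 'k::field) quadratic))"
    and no_overlap: "\<not> overlapping_triangles E"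
  shows "(\<forall>t>n. p t = 0) \<and>
    (\<forall>t. 2 * t \<le> n \<longrightarrow> p t \<ge> p (n - t)) \<and>
    ((\<forall>t. 2 * t \<le> n \<longrightarrow> p t = p (n - t)) \<longleftrightarrow> triangle_free E)"
proof -
  interpret graph_no_overlap n E
    using graph no_overlap by unfold_locales
  have p_card: "p t = card {X \<in> good. card X = t}" for t
    unfolding p by (rule hilbert_function_Q_dual)
  then have p_sum: "p t = (\<Sum>M\<in>matchings. level (card (free_vertices M)) (card M) t)" for t
    by (simp add: card_good)
  show ?thesis
  proof (intro conjI allI impI iffI)
    show "p t = 0" if "t > n" for t
      unfolding p_sum by (intro sum.neutral ballI level_0[OF card_free_vertices that])
    show "p t \<ge> p (n - t)" if "2 * t \<le> n" for t
      unfolding p_sum by (intro sum_mono level_reflect card_free_vertices that)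
    show "p t = p (n - t)" if "triangle_free E" "2 * t \<le> n" for t
      unfolding p_sum
      by (intro sum.cong refl level_symmetric[symmetric] card_free_vertices_triangle_free that)
    show "triangle_free E" if eq: "\<forall>t. 2 * t \<le> n \<longrightarrow> p t = p (n - t)"
      unfolding triangle_free_def
    proof
      assume "\<exists>T. triangle E T"
      then obtain T where T: "triangle E T" by blast
      \<comment> \<open>A triangle forces \<open>n \<ge> 3\<close>, so \<open>t = 1\<close> is in
        the range of the assumed equalities.\<close>
      have "card T \<le> card {1..n}" using triangle_le[OF T] by (intro card_mono) auto
      then have "p 1 = p (n - 1)" using eq triangle_card[OF T] by simp
      then show False using triangle_strict[OF T] by (simp add: p_card)
    qed
  qed
qed

end
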